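(* Let $(X,d)$ be a compact metric space and $\phi$ a regular expansive continuous flow on $X$. If $x_0\in X$ is a spiral point, then $\omega(x_0)$ is a periodic orbit.
   Context: A continuous flow is a continuous map $\phi\colon\mathbb{R}\times X\to X$, $\phi_t=\phi(t,\cdot)$, with $\phi_0=\mathrm{id}$, $\phi_{t+s}=\phi_s\circ\phi_t$; regular means no fixed points. Let $Rep$ be the set of increasing homeomorphisms $h\colon\mathbb{R}\to\mathbb{R}$ with $h(0)=0$. $\phi$ is expansive if for every $\varepsilon>0$ there is $\delta>0$ such that whenever $x,y\in X$, $h\in Rep$ and $d(\phi_t(x),\phi_{h(t)}(y))\le\delta$ for all $t\in\mathbb{R}$, then $y\in\phi_{[-\varepsilon,\varepsilon]}(x)$. A point $x\in X$ is a spiral point if there are $\tau>0$ and a continuous $g\colon\mathbb{R}\to\mathbb{R}$ with $g(t)>\tau+t$ for all $t\ge0$ and $d(\phi_t(x),\phi_{g(t)}(x))\to0$ as $t\to+\infty$. $\omega(x)=\{z:\exists t_k\to\infty,\ \phi_{t_k}(x)\to z\}$. A periodic orbit is the orbit $\{\phi_t(p):t\in\mathbb{R}\}$ of a point $p$ with $\phi_T(p)=p$ for some $T>0$. *)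

theory Defs
  imports "HOL-Analysis.Analysis"
begin

definition continuous_flow :: "(real \<Rightarrow> 'a::metric_space \<Rightarrow> 'a) \<Rightarrow> bool" where
  "continuous_flow \<phi> \<longleftrightarrow>
     continuous_on UNIV (\<lambda>(t, x). \<phi> t x) \<and>
     \<phi> 0 = id \<and>
     (\<forall>t s. \<phi> (t + s) = \<phi> s \<circ> \<phi> t)"

definition regular_flow :: "(real \<Rightarrow> 'a \<Rightarrow> 'a) \<Rightarrow> bool" where
  "regular_flow \<phi> \<longleftrightarrow> (\<forall>x. \<exists>t. \<phi> t x \<noteq> x)"

definition Rep :: "(real \<Rightarrow> real) set" where
  "Rep = {h. (\<exists>g. homeomorphism UNIV UNIV h g) \<and> strict_mono h \<and> h 0 = 0}"

definition expansive_flow :: "(real \<Rightarrow> 'a::metric_space \<Rightarrow> 'a) \<Rightarrow> bool" where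
  "expansive_flow \<phi> \<longleftrightarrow>
     (\<forall>\<epsilon>>0. \<exists>\<delta>>0. \<forall>x y h. h \<in> Rep \<and> (\<forall>t. dist (\<phi> t x) (\<phi> (h t) y) \<le> \<delta>)
        \<longrightarrow> y \<in> (\<lambda>s. \<phi> s x) ` {-\<epsilon>..\<epsilon>})"

definition spiral_point :: "(real \<Rightarrow> 'a::metric_space \<Rightarrow> 'a) \<Rightarrow> 'a \<Rightarrow> bool" where
  "spiral_point \<phi> x \<longleftrightarrow>
     (\<exists>\<tau>>0. \<exists>g::real \<Rightarrow> real. continuous_on UNIV g \<and> (\<forall>t\<ge>0. g t > \<tau> + t) \<and>
        ((\<lambda>t. dist (\<phi> t x) (\<phi> (g t) x)) \<longlongrightarrow> 0) at_top)"

definition omega_limit :: "(real \<Rightarrow> 'a::topological_space \<Rightarrow> 'a) \<Rightarrow> 'a \<Rightarrow> 'a set" where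
  "omega_limit \<phi> x = {z. \<exists>tk::nat \<Rightarrow> real. filterlim tk at_top sequentially \<and>
                              (\<lambda>k. \<phi> (tk k) x) \<longlonglongrightarrow> z}"

definition orbit :: "(real \<Rightarrow> 'a \<Rightarrow> 'a) \<Rightarrow> 'a \<Rightarrow> 'a set" where
  "orbit \<phi> p = range (\<lambda>t. \<phi> t p)"

definition periodic_orbit :: "(real \<Rightarrow> 'a \<Rightarrow> 'a) \<Rightarrow> 'a set \<Rightarrow> bool" where
  "periodic_orbit \<phi> S \<longleftrightarrow> (\<exists>p T. T > 0 \<and> \<phi> T p = p \<and> S = orbit \<phi> p)"

end

theory Submission
  imports Defs
begin

text \<open>
  Write \<open>x(t)\<close> for the orbit of \<open>x\<^sub>0\<close>. Absence of short periods forces \<open>g(t + u) - g(t) - u \<rightarrow> 0\<close> for bounded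
  \<open>u\<close>, so \<open>g\<close> may be replaced by an increasing homeomorphism \<open>G\<close>, and the orbit splits into loops
  \<open>[G\<^sup>n(T), G\<^sup>n\<^sup>+\<^sup>1(T)]\<close>, consecutive ones being ever closer to each other. The lengths of the loops might
  still be unbounded, so no periodic orbit is visible at once. The key point is that, for \<open>T\<close> large, the
  first loop is \<open>\<delta>\<close>-shadowed by all later ones: passing from one loop to the next costs a small error,
  and since shadowing of one loop carries over, through conjugation by \<open>G\<close>, to shadowing of any fixed
  number of earlier and later loops, expansivity on a long finite time window removes the error by a small time shift.
  Consequently the later loops have length comparable with the first one, hence they accumulate on a
  periodic orbit. Shadowing with smaller and smaller \<open>\<delta>\<close> shows that \<open>x(t)\<close> converges to that orbit.
\<close>

section \<open>Piecewise linear interpolation\<close>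

text \<open>Nodes sit at the integers, so bounds on \<open>a (k + 1) - a k\<close> are bounds on
  slopes.\<close>

definition interp :: "(int \<Rightarrow> real) \<Rightarrow> real \<Rightarrow> real" where
  "interp a u = a \<lfloor>u\<rfloor> + (u - \<lfloor>u\<rfloor>) * (a (\<lfloor>u\<rfloor> + 1) - a \<lfloor>u\<rfloor>)"

lemma interp_int [simp]: "interp a (of_int k) = a k"
  by (simp add: interp_def)

lemma interp_mono:
  assumes inc: "\<And>k. a k \<le> a (k + 1)" and "u \<le> v"
  shows "interp a u \<le> interp a v"
proof (cases "\<lfloor>u\<rfloor> = \<lfloor>v\<rfloor>")
  case True
  then show ?thesis
    using inc[of "\<lfloor>u\<rfloor>"] assms(2) by (simp add: interp_def mult_right_mono)
next
  case False
  then have lt: "\<lfloor>u\<rfloor> + 1 \<le> \<lfloor>v\<rfloor>"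
    using floor_mono[OF assms(2)] by linarith
  have mono: "a i \<le> a j" if "i \<le> j" for i j
    using that by (induction j rule: int_ge_induct) (auto intro: order_trans inc)
  have "(u - \<lfloor>u\<rfloor>) * (a (\<lfloor>u\<rfloor> + 1) - a \<lfloor>u\<rfloor>) \<le> 1 * (a (\<lfloor>u\<rfloor> + 1) - a \<lfloor>u\<rfloor>)"
    using inc[of "\<lfloor>u\<rfloor>"] by (intro mult_right_mono) linarith+
  then have "interp a u \<le> a (\<lfloor>u\<rfloor> + 1)"
    by (simp add: interp_def)
  also have "\<dots> \<le> a \<lfloor>v\<rfloor>"
    by (rule mono[OF lt])
  also have "\<dots> \<le> interp a v"
    using inc[of "\<lfloor>v\<rfloor>"] by (simp add: interp_def)
  finally show ?thesis .
qed

text \<open>Adding a linear sequence before interpolating turns a slope bound into monotonicity;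
  both increment bounds below follow from \<open>interp_mono\<close> in this way.\<close>

lemma interp_affine: "interp (\<lambda>k. p * a k + q * of_int k) u = p * interp a u + q * u"
  by (simp add: interp_def algebra_simps)

lemma interp_increment_ge:
  assumes "\<And>k. c \<le> a (k + 1) - a k" and "u \<le> v"
  shows "c * (v - u) \<le> interp a v - interp a u"
proof -
  have "interp (\<lambda>k. 1 * a k + (-c) * of_int k) u \<le> interp (\<lambda>k. 1 * a k + (-c) * of_int k) v"
    by (rule interp_mono) (use assms in \<open>auto simp: algebra_simps\<close>)
  then show ?thesis
    unfolding interp_affine by (simp add: algebra_simps)
qed

lemma interp_increment_le:
  assumes "\<And>k. a (k + 1) - a k \<le> C" and "u \<le> v"
  shows "interp a v - interp a u \<le> C * (v - u)"
proof -
  have "interp (\<lambda>k. (-1) * a k + C * of_int k) u \<le> interp (\<lambda>k. (-1) * a k + C * of_int k) v"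
    by (rule interp_mono) (use assms in \<open>auto simp: algebra_simps\<close>)
  then show ?thesis
    unfolding interp_affine by (simp add: algebra_simps)
qed

text \<open>Between nodes the interpolation is a convex combination of two node values. Strictness
  comes from the left node, whose weight \<open>1 - f\<close> is positive.\<close>

lemma interp_gt:
  assumes "\<And>k. p * of_int k + q < a k"
  shows "p * u + q < interp a u"
proof -
  define f where "f = u - of_int \<lfloor>u\<rfloor>"
  have f: "0 \<le> f" "f < 1" "u = of_int \<lfloor>u\<rfloor> + f"
    unfolding f_def by linarith+
  have "(1 - f) * (p * of_int \<lfloor>u\<rfloor> + q) < (1 - f) * a \<lfloor>u\<rfloor>"
    using f assms[of "\<lfloor>u\<rfloor>"] by simp
  moreover have "f * (p * of_int (\<lfloor>u\<rfloor> + 1) + q) \<le> f * a (\<lfloor>u\<rfloor> + 1)"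
    using f assms[of "\<lfloor>u\<rfloor> + 1"] by (intro mult_left_mono) auto
  moreover have "(1 - f) * (p * of_int \<lfloor>u\<rfloor> + q) + f * (p * of_int (\<lfloor>u\<rfloor> + 1) + q)
      = p * (of_int \<lfloor>u\<rfloor> + f) + q"
    by (simp add: algebra_simps)
  moreover have "interp a u = (1 - f) * a \<lfloor>u\<rfloor> + f * a (\<lfloor>u\<rfloor> + 1)"
    by (simp add: interp_def f_def algebra_simps)
  ultimately show ?thesis
    using f(3) by simp
qed

lemma interp_near_node:
  assumes "0 < c" "\<And>k. c \<le> a (k + 1) - a k" "\<And>k. a (k + 1) - a k \<le> C"
  shows "\<bar>interp a u - a \<lfloor>u\<rfloor>\<bar> \<le> C"
proof -
  have "c * (u - \<lfloor>u\<rfloor>) \<le> interp a u - interp a \<lfloor>u\<rfloor>" "interp a u - interp a \<lfloor>u\<rfloor> \<le> C * (u - \<lfloor>u\<rfloor>)"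
    by (intro interp_increment_ge interp_increment_le; use assms in simp)+
  moreover have "0 \<le> c * (u - \<lfloor>u\<rfloor>)"
    using assms(1) by simp
  moreover have "0 \<le> C"
    using assms(1) assms(2,3)[of 0] by linarith
  then have "C * (u - \<lfloor>u\<rfloor>) \<le> C * 1"
    by (intro mult_left_mono) linarith+
  ultimately show ?thesis
    by simp
qed

text \<open>Slopes between \<open>c\<close> and \<open>C\<close> make the interpolation strictly
  increasing and Lipschitz; the lower slope also makes it unbounded both ways, hence onto. The
  inverse is continuous because it is monotone with open range.\<close>

lemma interp_homeomorphism:
  assumes c: "0 < c" "\<And>k. c \<le> a (k + 1) - a k" and C: "\<And>k. a (k + 1) - a k \<le> C"
  obtains g where "homeomorphism UNIV UNIV (interp a) g" "strict_mono g" "strict_mono (interp a)"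
proof -
  note ge = interp_increment_ge[of c a, OF c(2)] and le = interp_increment_le[of a C, OF C]
  have sm: "strict_mono (interp a)"
  proof (rule strict_monoI)
    fix u v :: real assume "u < v"
    then show "interp a u < interp a v"
      using ge[of u v] c(1) by (smt (verit) mult_pos_pos)
  qed
  have "0 < C"
    using c(1) c(2)[of 0] C[of 0] by linarith
  have "C-lipschitz_on UNIV (interp a)"
  proof (rule lipschitz_onI)
    fix u v :: real
    show "dist (interp a u) (interp a v) \<le> C * dist u v"
    proof (cases "u \<le> v")
      case True
      then show ?thesis
        using le[of u v] strict_mono_less_eq[OF sm, of u v] by (simp add: dist_real_def)
    next
      case False
      then show ?thesis
        using le[of v u] strict_mono_less_eq[OF sm, of v u] by (simp add: dist_real_def)
    qed
  qed (use \<open>0 < C\<close> in simp)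
  then have cont: "continuous_on UNIV (interp a)"
    by (rule lipschitz_on_continuous_on)
  have "\<exists>u. interp a u = y" for y
  proof -
    define R where "R = \<bar>y - interp a 0\<bar> / c"
    have R: "0 \<le> R" "c * R = \<bar>y - interp a 0\<bar>"
      using c(1) by (auto simp: R_def)
    have "interp a (- R) \<le> y" "y \<le> interp a R"
      using ge[of "-R" 0] ge[of 0 R] R by auto
    then show ?thesis
      using IVT'[of "interp a" "-R" y R] continuous_on_subset[OF cont subset_UNIV] R(1) by auto
  qed
  then have surj: "surj (interp a)"
    by (metis surjI)
  define g where "g = inv (interp a)"
  have g: "interp a (g y) = y" "g (interp a u) = u" for y u
    using surj strict_mono_imp_inj_on[OF sm] by (auto simp: g_def surj_f_inv_f)
  have gm: "strict_mono g"
    by (rule strict_monoI) (metis g(1) sm strict_mono_less)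
  have "continuous_on UNIV g"
  proof (rule continuous_onI_mono)
    show "\<And>x y. x \<in> UNIV \<Longrightarrow> y \<in> UNIV \<Longrightarrow> x \<le> y \<Longrightarrow> g x \<le> g y"
      using strict_mono_less_eq[OF gm] by simp
    have "range g = UNIV"
      by (metis g(2) surjI)
    then show "open (range g)" by simp
  qed
  then have "homeomorphism UNIV UNIV (interp a) g"
    using cont surj g by (intro homeomorphismI) auto
  then show ?thesis
    using that gm sm by blast
qed

section \<open>Equivariant and slowly increasing sequences\<close>

text \<open>Telescoping away from the origin in both directions. The resulting bound on each
  coordinate is the same for all windows, which puts sample times of varying windows into one
  box.\<close>

lemma steps_bound:
  fixes a :: "int \<Rightarrow> real"
  assumes "a 0 = 0" "\<And>k. \<bar>k\<bar> \<le> int L \<Longrightarrow> 0 \<le> a (k + 1) - a k \<and> a (k + 1) - a k \<le> r" "\<bar>k\<bar> \<le> int L"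
  shows "\<bar>a k\<bar> \<le> \<bar>of_int k\<bar> * r"
proof (cases "0 \<le> k")
  case True
  have "k \<le> int L \<longrightarrow> 0 \<le> a k \<and> a k \<le> of_int k * r"
    using True
  proof (induction k rule: int_ge_induct)
    case (step i)
    then show ?case using assms(2)[of i] by (auto simp: algebra_simps)
  qed (use assms(1) in simp)
  then show ?thesis using True assms(3) by simp
next
  case False
  then have "k \<le> 0" by simp
  then have "- int L \<le> k \<longrightarrow> a k \<le> 0 \<and> of_int k * r \<le> a k"
  proof (induction k rule: int_le_induct)
    case (step i)
    then show ?case using assms(2)[of "i - 1"] by (auto simp: algebra_simps)
  qed (use assms(1) in simp)
  then show ?thesis using False assms(3) by simp
qed

text \<open>Tychonoff's theorem for a product of compact intervals. Since the index set is
  countable, this later yields convergent subsequences of whole time sequences.\<close>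

lemma compact_box:
  fixes B :: "int \<Rightarrow> real"
  shows "compact {f. \<forall>k. \<bar>f k\<bar> \<le> B k}"
proof -
  have "compactin (product_topology (\<lambda>_::int. euclideanreal) UNIV) (PiE UNIV (\<lambda>k. {-B k..B k}))"
    by (simp add: compactin_PiE)
  moreover have "PiE UNIV (\<lambda>k. {-B k..B k}) = {f. \<forall>k. \<bar>f k\<bar> \<le> B k}"
    by (auto simp: PiE_def Pi_def abs_le_iff minus_le_iff)
  ultimately show ?thesis
    by (simp add: euclidean_product_topology)
qed

text \<open>The window \<open>0 \<le> k < N\<close> is a fundamental domain for the shift by
  \<open>N\<close>: values there are free, later blocks come from iterating \<open>G\<close>,
  earlier ones from iterating its right inverse \<open>G'\<close>.\<close>

lemma equivariant_extension:
  fixes N :: int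
  assumes "\<And>t. G (G' t) = t" "0 < N"
  obtains F where "\<And>k. 0 \<le> k \<Longrightarrow> k < N \<Longrightarrow> F k = f k" "\<And>k. F (k + N) = G (F k)"
proof -
  define F where "F k = (if 0 \<le> k div N then (G ^^ nat (k div N)) (f (k mod N))
    else (G' ^^ nat (- (k div N))) (f (k mod N)))" for k
  show thesis
  proof (rule that[of F])
    fix k
    have dm: "(k + N) div N = k div N + 1" "(k + N) mod N = k mod N"
      using assms(2) by simp_all
    \<comment> \<open>Block -1 is the one that \<open>G\<close> maps onto the prescribed values,
      where the definition of \<open>F\<close> changes branch.\<close>
    consider "0 \<le> k div N" | "k div N = -1" | "k div N < -1" by linarith
    then show "F (k + N) = G (F k)"
    proof cases
      case 1
      then show ?thesis by (simp add: F_def dm nat_add_distrib)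
    next
      case 2
      then show ?thesis by (simp add: F_def dm assms(1))
    next
      case 3
      then have "nat (- (k div N)) = Suc (nat (- (k div N + 1)))" by simp
      then have "(G' ^^ nat (- (k div N))) (f (k mod N))
          = G' ((G' ^^ nat (- (k div N + 1))) (f (k mod N)))"
        by (simp only: funpow.simps o_apply)
      then show ?thesis
        using 3 unfolding F_def dm by (simp add: assms(1))
    qed
  qed (simp add: F_def)
qed

text \<open>The index \<open>n\<close> of \<open>Q\<close> counts the periods separating \<open>k\<close> from the window \<open>{0..<N}\<close>; \<open>Q\<close> may
  weaken with \<open>n\<close>, as error bounds do.\<close>

lemma loop_induct:
  fixes N :: int and Q :: "nat \<Rightarrow> int \<Rightarrow> bool"
  assumes N: "0 < N"
    and base: "\<And>k. 0 \<le> k \<Longrightarrow> k < N \<Longrightarrow> Q 0 k"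
    and mono: "\<And>n k. Q n k \<Longrightarrow> Q (Suc n) k"
    and up: "\<And>n k. \<lbrakk>n < L; - int L * N \<le> k; Q n k\<rbrakk> \<Longrightarrow> Q (Suc n) (k + N)"
    and down: "\<And>n k. \<lbrakk>n < L; - int L * N \<le> k; Q n (k + N)\<rbrakk> \<Longrightarrow> Q (Suc n) k"
  shows "n \<le> L \<Longrightarrow> - int n * N \<le> k \<Longrightarrow> k < (int n + 1) * N \<Longrightarrow> Q n k"
proof (induction n arbitrary: k)
  case 0
  then show ?case using base by simp
next
  case (Suc n)
  define m where "m = int n * N"
  define M where "M = int L * N"
  have "int (Suc n) * N \<le> int L * N"
    using Suc.prems(1) N by (intro mult_right_mono) auto
  then have m: "0 \<le> m" "m + N \<le> M"
    using N by (simp_all add: m_def M_def algebra_simps)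
  have k: "- m - N \<le> k" "k < m + N + N"
    using Suc.prems(2,3) by (simp_all add: m_def algebra_simps)
  have IH: "Q n i" if "- m \<le> i" "i < m + N" for i
    using Suc.IH[of i] Suc.prems(1) that by (simp add: m_def algebra_simps)
  have M': "- int L * N = - M"
    by (simp add: M_def)
  consider "k < - m" | "- m \<le> k" "k < m + N" | "m + N \<le> k"
    by linarith
  then show ?case
  proof cases
    case 1
    then have "Q n (k + N)"
      using k m by (intro IH) auto
    moreover have "- int L * N \<le> k"
      unfolding M' using k m by linarith
    ultimately show ?thesis
      using Suc.prems(1) by (intro down) auto
  next
    case 2
    then show ?thesis by (intro mono IH)
  next
    case 3
    then have "Q n (k - N)"
      using k m by (intro IH) auto
    moreover have "- int L * N \<le> k - N"
      unfolding M' using 3 m N by linarith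
    ultimately show ?thesis
      using up[of n "k - N"] Suc.prems(1) by simp
  qed
qed

lemma equivariant_funpow:
  fixes N :: int
  assumes "\<And>k. F (k + N) = G (F k)"
  shows "F (k + int n * N) = (G ^^ n) (F k)"
proof (induction n)
  case (Suc n)
  have "F (k + int (Suc n) * N) = F ((k + int n * N) + N)"
    by (simp add: algebra_simps)
  then show ?case by (simp add: assms Suc)
qed simp

text \<open>An increasing \<open>G\<close> preserves and reflects the order, so an inequality on one
  fundamental domain spreads in both directions.\<close>

lemma equivariant_le:
  fixes N :: int and G :: "real \<Rightarrow> real"
  assumes N: "0 < N" and G: "strict_mono G"
    and F: "\<And>k. F (k + N) = G (F k)" and H: "\<And>k. H (k + N) = G (H k)"
    and le: "\<And>k. 0 \<le> k \<Longrightarrow> k < N \<Longrightarrow> F k \<le> H k"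
  shows "F k \<le> H k"
proof -
  \<comment> \<open>Since \<open>N\<close> is at least 1, \<open>\<bar>k\<bar>\<close> periods are
    enough to reach \<open>k\<close> from the base window.\<close>
  define n where "n = nat \<bar>k\<bar>"
  have kn: "- int n * N \<le> k" "k < (int n + 1) * N"
  proof -
    have "int n * 1 \<le> int n * N"
      using N by (intro mult_left_mono) auto
    then show "- int n * N \<le> k" "k < (int n + 1) * N"
      using N by (auto simp: n_def algebra_simps)
  qed
  show ?thesis
    by (rule loop_induct[of N "\<lambda>_ k. F k \<le> H k" n n k])
      (use N le kn strict_mono_less_eq[OF G] in \<open>auto simp: F H\<close>)
qed

section \<open>Regular flows on compact spaces\<close>

locale compact_regular_flow =
  fixes \<phi> :: "real \<Rightarrow> 'a::metric_space \<Rightarrow> 'a"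
  assumes cpt: "compact (UNIV :: 'a set)"
    and flow: "continuous_flow \<phi>"
    and reg: "regular_flow \<phi>"
begin

lemma flow_0 [simp]: "\<phi> 0 x = x"
  using flow by (simp add: continuous_flow_def)

lemma flow_add: "\<phi> s (\<phi> t x) = \<phi> (t + s) x"
  using flow by (simp add: continuous_flow_def)

lemma flow_continuous [continuous_intros]:
  assumes "continuous_on S f" "continuous_on S g"
  shows "continuous_on S (\<lambda>z. \<phi> (f z) (g z))"
proof -
  have "continuous_on UNIV (\<lambda>p. \<phi> (fst p) (snd p))"
    using flow by (simp add: continuous_flow_def case_prod_unfold)
  from continuous_on_compose2[OF this continuous_on_Pair[OF assms]] show ?thesis
    by simp
qed

lemma flow_tendsto [tendsto_intros]:
  assumes "(f \<longlongrightarrow> s) F" "(g \<longlongrightarrow> x) F"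
  shows "((\<lambda>z. \<phi> (f z) (g z)) \<longlongrightarrow> \<phi> s x) F"
proof -
  have "continuous_on UNIV (\<lambda>p. \<phi> (fst p) (snd p))"
    using flow by (simp add: continuous_flow_def case_prod_unfold)
  then have "isCont (\<lambda>p. \<phi> (fst p) (snd p)) (s, x)"
    by (simp add: continuous_on_eq_continuous_at)
  from isCont_tendsto_compose[OF this tendsto_Pair[OF assms]] show ?thesis
    by simp
qed

lemma convergent_subseq:
  fixes z :: "nat \<Rightarrow> 'a"
  obtains w k where "strict_mono (k :: nat \<Rightarrow> nat)" "(z \<circ> k) \<longlonglongrightarrow> w"
  using compact_imp_seq_compact[OF cpt] unfolding seq_compact_def by (metis UNIV_I)

lemma flow_uniformly_continuous:
  fixes \<kappa> R :: real
  assumes "0 < \<kappa>"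
  obtains d where "0 < d" "\<And>s t (p::'a) q. \<lbrakk>\<bar>s\<bar> \<le> R; \<bar>t\<bar> \<le> R; dist (s, p) (t, q) < d\<rbrakk>
    \<Longrightarrow> dist (\<phi> s p) (\<phi> t q) < \<kappa>"
proof -
  have "uniformly_continuous_on ({-R..R} \<times> UNIV) (\<lambda>p. \<phi> (fst p) (snd p))"
    by (intro compact_uniformly_continuous continuous_intros compact_Times cpt compact_Icc)
  then obtain d where d: "0 < d" "\<forall>p\<in>{-R..R} \<times> UNIV. \<forall>q\<in>{-R..R} \<times> UNIV.
      dist q p < d \<longrightarrow> dist (\<phi> (fst q) (snd q)) (\<phi> (fst p) (snd p)) < \<kappa>"
    using assms unfolding uniformly_continuous_on_def by blast
  show thesis
  proof (rule that[OF d(1)])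
    fix s t :: real and p q :: 'a
    assume h: "\<bar>s\<bar> \<le> R" "\<bar>t\<bar> \<le> R" "dist (s, p) (t, q) < d"
    have "(s, p) \<in> {-R..R} \<times> UNIV" "(t, q) \<in> {-R..R} \<times> UNIV"
      using h by auto
    with d(2) h(3) show "dist (\<phi> s p) (\<phi> t q) < \<kappa>"
      by fastforce
  qed
qed

lemma flow_uniform:
  fixes \<kappa> R R' :: real
  assumes "0 < \<kappa>" "0 < R'"
  shows "\<exists>\<delta>>0. \<delta> \<le> R' \<and> (\<forall>s p q. \<bar>s\<bar> \<le> R \<and> dist p q \<le> \<delta> \<longrightarrow> dist (\<phi> s p) (\<phi> s q) < \<kappa>)"
proof -
  obtain d where d: "0 < d" "\<And>s t (p::'a) q. \<lbrakk>\<bar>s\<bar> \<le> R; \<bar>t\<bar> \<le> R; dist (s, p) (t, q) < d\<rbrakk>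
    \<Longrightarrow> dist (\<phi> s p) (\<phi> t q) < \<kappa>"
    using flow_uniformly_continuous[OF assms(1), of R] by blast
  have "dist (\<phi> s p) (\<phi> s q) < \<kappa>" if "\<bar>s\<bar> \<le> R" "dist p q \<le> min (d / 2) R'" for s p q
    using that d(1) by (intro d(2)) (auto simp: dist_Pair_Pair)
  then show ?thesis
    using d(1) assms(2) by (intro exI[of _ "min (d / 2) R'"]) auto
qed

lemma flow_short_time:
  assumes "0 < \<kappa>"
  obtains r where "0 < r" "\<And>s p. \<bar>s\<bar> \<le> r \<Longrightarrow> dist (\<phi> s p) p < \<kappa>"
proof -
  obtain d where d: "0 < d" "\<And>s t p q. \<lbrakk>\<bar>s\<bar> \<le> 1; \<bar>t\<bar> \<le> 1; dist (s, p) (t, q) < d\<rbrakk>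
    \<Longrightarrow> dist (\<phi> s p) (\<phi> t q) < \<kappa>"
    using flow_uniformly_continuous[OF assms, of 1] by blast
  show thesis
  proof (rule that[of "min (d / 2) 1"])
    fix s p assume "\<bar>s\<bar> \<le> min (d / 2) 1"
    then show "dist (\<phi> s p) p < \<kappa>"
      using d(1) d(2)[of s 0 p p] by (simp add: dist_Pair_Pair)
  qed (use d(1) in auto)
qed

section \<open>Absence of short periods and synchronisation of orbit pieces\<close>

definition aperiodic_upto :: "real \<Rightarrow> bool" where
  "aperiodic_upto r \<longleftrightarrow> (\<forall>s z. 0 < \<bar>s\<bar> \<and> \<bar>s\<bar> \<le> r \<longrightarrow> \<phi> s z \<noteq> z)"

text \<open>If periods \<open>s n\<close> of points \<open>z n\<close> tended to 0, every time
  \<open>t\<close> would be almost a multiple of \<open>s n\<close>. A limit point of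
  \<open>z n\<close> would then be fixed by the whole flow, against regularity.\<close>

lemma no_short_period:
  obtains r0 where "0 < r0" "aperiodic_upto r0"
proof -
  have "\<exists>r0>0. \<forall>s z. 0 < s \<and> s \<le> r0 \<longrightarrow> \<phi> s z \<noteq> z"
  proof (rule ccontr)
    assume neg: "\<not> ?thesis"
    have "\<exists>s z. 0 < s \<and> s \<le> inverse (real (Suc n)) \<and> \<phi> s z = z" for n
    proof (rule ccontr)
      assume "\<not> ?thesis"
      then have "\<forall>s z. 0 < s \<and> s \<le> inverse (real (Suc n)) \<longrightarrow> \<phi> s z \<noteq> z"
        by blast
      moreover have "0 < inverse (real (Suc n))" by simp
      ultimately show False using neg by blast
    qed
    then obtain s z where s: "\<And>n. 0 < s n" "\<And>n. s n \<le> inverse (real (Suc n))"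
      and z: "\<And>n. \<phi> (s n) (z n) = z n"
      by metis
    obtain w k where k: "strict_mono (k :: nat \<Rightarrow> nat)" "(z \<circ> k) \<longlonglongrightarrow> w"
      by (rule convergent_subseq)
    have s_nonneg: "0 \<le> s n" for n
      using s(1)[of n] by simp
    have s0: "s \<longlonglongrightarrow> 0"
      by (rule tendsto_sandwich[OF _ _ tendsto_const LIMSEQ_inverse_real_of_nat])
        (use s(2) s_nonneg in auto)
    have per: "\<phi> (of_nat m * s n) (z n) = z n" for m n
      by (induction m) (simp_all add: algebra_simps flow_add[symmetric] z)
    have per_int: "\<phi> (of_int i * s n) (z n) = z n" for i n
    proof (cases "0 \<le> i")
      case True
      then show ?thesis using per[of "nat i" n] by simp
    next
      case False
      then have "\<phi> (- (of_int i * s n)) (z n) = z n"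
        using per[of "nat (-i)" n] by simp
      then have "\<phi> (of_int i * s n) (z n) = \<phi> (of_int i * s n) (\<phi> (- (of_int i * s n)) (z n))"
        by (simp only:)
      then show ?thesis by (simp add: flow_add)
    qed
    have "\<phi> t w = w" for t
    proof -
      \<comment> \<open>The remainder of \<open>t\<close> modulo the period \<open>s n\<close>: it
        tends to 0, so time \<open>t\<close> acts on the limit \<open>w\<close> like time 0.\<close>
      define v where "v n = t - of_int \<lfloor>t / s n\<rfloor> * s n" for n
      have v: "0 \<le> v n \<and> v n \<le> s n" for n
        using s(1)[of n] floor_divide_lower[of "s n" t] floor_divide_upper[of "s n" t]
        by (simp add: v_def algebra_simps)
      have v0: "v \<longlonglongrightarrow> 0"
        by (rule tendsto_sandwich[OF _ _ tendsto_const s0]) (use v in auto)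
      have "\<phi> t (z n) = \<phi> (v n) (z n)" for n
      proof -
        have "\<phi> t (z n) = \<phi> (v n) (\<phi> (of_int \<lfloor>t / s n\<rfloor> * s n) (z n))"
          by (simp add: flow_add v_def)
        then show ?thesis by (simp add: per_int)
      qed
      then have "(\<lambda>n. \<phi> t (z (k n))) = (\<lambda>n. \<phi> (v (k n)) (z (k n)))"
        by simp
      moreover have "(\<lambda>n. \<phi> t (z (k n))) \<longlonglongrightarrow> \<phi> t w"
        using k(2) by (intro tendsto_intros) (simp add: o_def)
      moreover have "(\<lambda>n. \<phi> (v (k n)) (z (k n))) \<longlonglongrightarrow> \<phi> 0 w"
        using k(2) LIMSEQ_subseq_LIMSEQ[OF v0 k(1)] by (intro tendsto_intros) (simp_all add: o_def)
      ultimately show ?thesis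
        using LIMSEQ_unique by fastforce
    qed
    then show False
      using reg unfolding regular_flow_def by blast
  qed
  then obtain r0 where r0: "r0 > 0" "\<And>s z. 0 < s \<Longrightarrow> s \<le> r0 \<Longrightarrow> \<phi> s z \<noteq> z"
    by blast
  have "\<phi> s z \<noteq> z" if "0 < \<bar>s\<bar>" "\<bar>s\<bar> \<le> r0" for s z
    using that r0(2)[of "\<bar>s\<bar>" z] flow_add[of "-s" s z] by (auto simp: abs_if split: if_splits)
  then show thesis
    using that[OF r0(1)] by (simp add: aperiodic_upto_def)
qed

text \<open>By compactness, times \<open>s\<close> with
  \<open>\<eta> \<le> \<bar>s\<bar> \<le> r0\<close> move every point by at least some \<kappa> > 0.
  If two pieces start close and end close, then \<open>\<phi> u p\<close> and
  \<open>\<phi> v p\<close> are closer than \<kappa>, so \<open>u - v\<close> cannot be such a time;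
  the bounds \<open>r0 / 2\<close> keep it within \<open>r0\<close>.\<close>

lemma synchronised:
  assumes per: "aperiodic_upto r0" and "0 < \<eta>"
  obtains \<delta> where "0 < \<delta>"
    "\<And>p q u v. \<lbrakk>\<bar>u\<bar> \<le> r0 / 2; \<bar>v\<bar> \<le> r0 / 2; dist p q \<le> \<delta>; dist (\<phi> u p) (\<phi> v q) \<le> \<delta>\<rbrakk>
      \<Longrightarrow> \<bar>u - v\<bar> < \<eta>"
proof -
  define K where "K = ({-r0..-\<eta>} \<union> {\<eta>..r0}) \<times> (UNIV :: 'a set)"
  obtain \<kappa> where \<kappa>: "0 < \<kappa>" "\<And>s z. \<eta> \<le> \<bar>s\<bar> \<Longrightarrow> \<bar>s\<bar> \<le> r0 \<Longrightarrow> \<kappa> \<le> dist (\<phi> s z) z"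
  \<comment> \<open>\<open>K\<close> is empty when \<eta> exceeds \<open>r0\<close>; then no time is
    in range and any positive \<kappa> serves.\<close>
  proof (cases "K = {}")
    case True
    then show ?thesis
      using that[of 1] assms(2) by (force simp: K_def abs_if split: if_splits)
  next
    case False
    have "compact K"
      unfolding K_def by (intro compact_Times cpt compact_Un compact_Icc)
    moreover have "continuous_on K (\<lambda>p. dist (\<phi> (fst p) (snd p)) (snd p))"
      by (intro continuous_intros)
    ultimately obtain p0 where p0: "p0 \<in> K"
      "\<And>p. p \<in> K \<Longrightarrow> dist (\<phi> (fst p0) (snd p0)) (snd p0) \<le> dist (\<phi> (fst p) (snd p)) (snd p)"
      using continuous_attains_inf[of K] False by blast
    show ?thesis
    proof (rule that[of "dist (\<phi> (fst p0) (snd p0)) (snd p0)"])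
      show "0 < dist (\<phi> (fst p0) (snd p0)) (snd p0)"
        using p0(1) per assms(2) by (auto simp: K_def aperiodic_upto_def)
      fix s z assume "\<eta> \<le> \<bar>s\<bar>" "\<bar>s\<bar> \<le> r0"
      then have "(s, z) \<in> K" by (auto simp: K_def)
      from p0(2)[OF this] show "dist (\<phi> (fst p0) (snd p0)) (snd p0) \<le> dist (\<phi> s z) z"
        by simp
    qed
  qed
  obtain \<delta> where \<delta>: "0 < \<delta>" "\<delta> \<le> \<kappa> / 2"
    "\<And>s p q. \<bar>s\<bar> \<le> r0 / 2 \<Longrightarrow> dist p q \<le> \<delta> \<Longrightarrow> dist (\<phi> s p) (\<phi> s q) < \<kappa> / 2"
    using flow_uniform[OF half_gt_zero[OF \<kappa>(1)] half_gt_zero[OF \<kappa>(1)], of "r0 / 2"] by blast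
  show thesis
  proof (rule that[OF \<delta>(1)])
    fix p q u v
    assume h: "\<bar>u\<bar> \<le> r0 / 2" "\<bar>v\<bar> \<le> r0 / 2" "dist p q \<le> \<delta>" "dist (\<phi> u p) (\<phi> v q) \<le> \<delta>"
    have "dist (\<phi> u p) (\<phi> v p) < \<kappa>"
      using \<delta>(3)[of v p q] \<delta>(2) h dist_triangle[of "\<phi> u p" "\<phi> v p" "\<phi> v q"]
      by (simp add: dist_commute)
    then have "dist (\<phi> (u - v) (\<phi> v p)) (\<phi> v p) < \<kappa>"
      by (simp add: flow_add)
    then show "\<bar>u - v\<bar> < \<eta>"
      using \<kappa>(2)[of "u - v" "\<phi> v p"] h(1,2) by linarith
  qed
qed

section \<open>Expansivity for orbits sampled at discrete times\<close>

text \<open>Steps of length at most \<open>r\<close> move points by less than a third of the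
  expansivity constant, so closeness at the samples gives closeness throughout. The positive lower
  bound \<open>c\<close> on the steps ensures that the interpolated time change is a
  homeomorphism.\<close>

lemma discrete_expansive:
  assumes "expansive_flow \<phi>" "0 < \<epsilon>"
  obtains r \<delta> where "0 < r" "0 < \<delta>"
    "\<And>x y a b c. \<lbrakk>0 < c; a 0 = 0; b 0 = 0;
      \<And>k::int. c \<le> a (k + 1) - a k \<and> a (k + 1) - a k \<le> r;
      \<And>k. c \<le> b (k + 1) - b k \<and> b (k + 1) - b k \<le> r;
      \<And>k. dist (\<phi> (a k) x) (\<phi> (b k) y) \<le> \<delta>\<rbrakk> \<Longrightarrow> \<exists>s. \<bar>s\<bar> \<le> \<epsilon> \<and> x = \<phi> s y"
proof -
  obtain d where d: "0 < d" "\<And>x y h. h \<in> Rep \<Longrightarrow> (\<forall>t. dist (\<phi> t x) (\<phi> (h t) y) \<le> d) \<Longrightarrow>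
      y \<in> (\<lambda>s. \<phi> s x) ` {-\<epsilon>..\<epsilon>}"
    using assms unfolding expansive_flow_def by meson
  obtain r where r: "0 < r" "\<And>s p. \<bar>s\<bar> \<le> r \<Longrightarrow> dist (\<phi> s p) p < d / 3"
    using flow_short_time[of "d / 3"] d(1) by auto
  show thesis
  proof (rule that[of r "d / 3"])
    fix x y a b c
    assume c: "0 < c" and zero: "a 0 = 0" "b 0 = 0"
      and a: "\<And>k::int. c \<le> a (k + 1) - a k \<and> a (k + 1) - a k \<le> r"
      and b: "\<And>k. c \<le> b (k + 1) - b k \<and> b (k + 1) - b k \<le> r"
      and close: "\<And>k. dist (\<phi> (a k) x) (\<phi> (b k) y) \<le> d / 3"
    obtain ga where ga: "homeomorphism UNIV UNIV (interp a) ga" "strict_mono ga"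
      using interp_homeomorphism[OF c, of a r] a by blast
    obtain gb where gb: "homeomorphism UNIV UNIV (interp b) gb" "strict_mono (interp b)"
      using interp_homeomorphism[OF c, of b r] b by blast
    \<comment> \<open>The time change that matches each sample time \<open>a k\<close> with
      \<open>b k\<close>.\<close>
    define h where "h = interp b \<circ> ga"
    have "homeomorphism UNIV UNIV h (interp a \<circ> gb)"
      unfolding h_def using homeomorphism_compose[OF homeomorphism_symD[OF ga(1)] gb(1)] .
    moreover have "strict_mono h"
      unfolding h_def using strict_mono_o[OF gb(2) ga(2)] .
    moreover have ga_interp: "ga (interp a u) = u" "interp a (ga t) = t" for u t
      using ga(1) by (auto simp: homeomorphism_def)
    have "h 0 = 0"
      using ga_interp(1)[of 0] interp_int[of a 0] interp_int[of b 0] zero by (simp add: h_def)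
    ultimately have "h \<in> Rep"
      by (auto simp: Rep_def)
    moreover have "dist (\<phi> t x) (\<phi> (h t) y) \<le> d" for t
    proof -
      define k where "k = \<lfloor>ga t\<rfloor>"
      have "\<bar>t - a k\<bar> \<le> r" "\<bar>h t - b k\<bar> \<le> r"
        using interp_near_node[OF c, of a r "ga t"] interp_near_node[OF c, of b r "ga t"] a b
        by (auto simp: ga_interp k_def h_def)
      then have "dist (\<phi> (t - a k) (\<phi> (a k) x)) (\<phi> (a k) x) < d / 3"
        "dist (\<phi> (h t - b k) (\<phi> (b k) y)) (\<phi> (b k) y) < d / 3"
        using r(2) by blast+
      then have "dist (\<phi> t x) (\<phi> (a k) x) < d / 3" "dist (\<phi> (h t) y) (\<phi> (b k) y) < d / 3"
        by (simp_all add: flow_add)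
      then show ?thesis
        using close[of k] dist_triangle[of "\<phi> t x" "\<phi> (h t) y" "\<phi> (a k) x"]
          dist_triangle[of "\<phi> (a k) x" "\<phi> (h t) y" "\<phi> (b k) y"]
        by (simp add: dist_commute)
    qed
    ultimately have "y \<in> (\<lambda>s. \<phi> s x) ` {-\<epsilon>..\<epsilon>}"
      using d(2) by blast
    then obtain s where s: "y = \<phi> s x" "\<bar>s\<bar> \<le> \<epsilon>" by auto
    then have "x = \<phi> (- s) y" by (simp add: flow_add)
    then show "\<exists>s. \<bar>s\<bar> \<le> \<epsilon> \<and> x = \<phi> s y"
      using s(2) by (metis abs_minus_cancel)
  qed (use r d in auto)
qed

text \<open>If no window length sufficed, the failing samples would have a limit that tracks at all
  times, against \<open>discrete_expansive\<close>. The order of quantifiers matters: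
  \<open>r\<close> and \<delta> come first, and only \<open>L\<close> depends on \<open>c\<close>
  and \<delta>', so the sampling grid may be chosen after \<open>r\<close> is known.\<close>

lemma uniform_expansive:
  assumes "expansive_flow \<phi>" "0 < \<epsilon>"
  obtains r \<delta> where "0 < r" "0 < \<delta>"
    "\<And>c \<delta>'. \<lbrakk>0 < c; 0 < \<delta>'\<rbrakk> \<Longrightarrow> \<exists>L. \<forall>x y a b. a 0 = 0 \<and> b 0 = 0 \<and>
       (\<forall>k::int. \<bar>k\<bar> \<le> int L \<longrightarrow> c \<le> a (k + 1) - a k \<and> a (k + 1) - a k \<le> r \<and>
          c \<le> b (k + 1) - b k \<and> b (k + 1) - b k \<le> r \<and>
          dist (\<phi> (a k) x) (\<phi> (b k) y) \<le> \<delta>) \<longrightarrow>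
       (\<exists>s. \<bar>s\<bar> \<le> \<epsilon> \<and> dist x (\<phi> s y) < \<delta>')"
proof -
  obtain r \<delta> where r: "0 < r" "0 < \<delta>" and exp:
    "\<And>x y a b c. \<lbrakk>0 < c; a 0 = 0; b 0 = 0;
      \<And>k::int. c \<le> a (k + 1) - a k \<and> a (k + 1) - a k \<le> r;
      \<And>k. c \<le> b (k + 1) - b k \<and> b (k + 1) - b k \<le> r;
      \<And>k. dist (\<phi> (a k) x) (\<phi> (b k) y) \<le> \<delta>\<rbrakk> \<Longrightarrow> \<exists>s. \<bar>s\<bar> \<le> \<epsilon> \<and> x = \<phi> s y"
    using discrete_expansive[OF assms] by blast
  define track where "track c x y a b k \<longleftrightarrow> c \<le> a (k + 1) - a k \<and> a (k + 1) - a k \<le> r \<and>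
          c \<le> b (k + 1) - b k \<and> b (k + 1) - b k \<le> r \<and>
          dist (\<phi> (a k) x) (\<phi> (b k) y) \<le> \<delta>" for c x y a b and k :: int
  have "\<exists>L. \<forall>x y a b. a 0 = 0 \<and> b 0 = 0 \<and> (\<forall>k. \<bar>k\<bar> \<le> int L \<longrightarrow> track c x y a b k) \<longrightarrow>
       (\<exists>s. \<bar>s\<bar> \<le> \<epsilon> \<and> dist x (\<phi> s y) < \<delta>')" if c: "0 < c" and \<delta>': "0 < \<delta>'" for c \<delta>'
  proof (rule ccontr)
    assume "\<not> ?thesis"
    then have "\<forall>L. \<exists>x y a b. a 0 = 0 \<and> b 0 = 0 \<and> (\<forall>k. \<bar>k\<bar> \<le> int L \<longrightarrow> track c x y a b k) \<and>
       (\<forall>s. \<bar>s\<bar> \<le> \<epsilon> \<longrightarrow> \<delta>' \<le> dist x (\<phi> s y))"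
      by (simp add: not_less) metis
    then obtain X Y A B where zero: "\<And>L. A L 0 = 0" "\<And>L. B L 0 = 0"
      and tr: "\<And>L k. \<bar>k\<bar> \<le> int L \<Longrightarrow> track c (X L) (Y L) (A L) (B L) k"
      and far: "\<And>L s. \<bar>s\<bar> \<le> \<epsilon> \<Longrightarrow> \<delta>' \<le> dist (X L) (\<phi> s (Y L))"
      by metis
    \<comment> \<open>Outside the window the sequences are arbitrary; clipping puts them into one compact box.\<close>
    define clip where "clip f L k = (if \<bar>k\<bar> \<le> int L then f L k else 0)"
      for f :: "nat \<Rightarrow> int \<Rightarrow> real" and L k
    define S where "S = {f :: int \<Rightarrow> real. \<forall>k. \<bar>f k\<bar> \<le> \<bar>of_int k\<bar> * r}"
    have "clip A L \<in> S" "clip B L \<in> S" for L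
    proof -
      have "0 \<le> A L (k + 1) - A L k \<and> A L (k + 1) - A L k \<le> r"
        "0 \<le> B L (k + 1) - B L k \<and> B L (k + 1) - B L k \<le> r" if "\<bar>k\<bar> \<le> int L" for k
        using tr[OF that] c by (auto simp: track_def)
      then have "\<bar>A L k\<bar> \<le> \<bar>of_int k\<bar> * r" "\<bar>B L k\<bar> \<le> \<bar>of_int k\<bar> * r" if "\<bar>k\<bar> \<le> int L" for k
        using steps_bound[of "A L" L r k] steps_bound[of "B L" L r k] that zero by blast+
      then show "clip A L \<in> S" "clip B L \<in> S"
        using r(1) by (auto simp: S_def clip_def)
    qed
    then have inS: "\<forall>n. (X n, Y n, clip A n, clip B n) \<in> UNIV \<times> UNIV \<times> S \<times> S"
      by simp
    have "compact ((UNIV::'a set) \<times> (UNIV::'a set) \<times> S \<times> S)"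
      unfolding S_def by (intro compact_Times cpt compact_box)
    from compact_imp_seq_compact[OF this, unfolded seq_compact_def, rule_format,
      of "\<lambda>n. (X n, Y n, clip A n, clip B n)"] inS
    obtain l q where q: "strict_mono (q :: nat \<Rightarrow> nat)"
      and l: "((\<lambda>n. (X n, Y n, clip A n, clip B n)) \<circ> q) \<longlonglongrightarrow> l"
      by auto
    obtain x y \<alpha> \<beta> where l_eq: "l = (x, y, \<alpha>, \<beta>)"
      by (metis prod.exhaust)
    have X: "(\<lambda>n. X (q n)) \<longlonglongrightarrow> x" and Y: "(\<lambda>n. Y (q n)) \<longlonglongrightarrow> y"
      and clips: "(\<lambda>n. clip A (q n)) \<longlonglongrightarrow> \<alpha>" "(\<lambda>n. clip B (q n)) \<longlonglongrightarrow> \<beta>"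
      using tendsto_fst[OF l] tendsto_fst[OF tendsto_snd[OF l]]
        tendsto_fst[OF tendsto_snd[OF tendsto_snd[OF l]]]
        tendsto_snd[OF tendsto_snd[OF tendsto_snd[OF l]]]
      by (simp_all add: o_def l_eq)
    have large: "\<forall>\<^sub>F n in sequentially. \<bar>k\<bar> \<le> int (q n)" for k
    proof (rule eventually_sequentiallyI[of "nat \<bar>k\<bar>"])
      fix n assume "nat \<bar>k\<bar> \<le> n"
      then show "\<bar>k\<bar> \<le> int (q n)"
        using seq_suble[OF q, of n] by linarith
    qed
    have coord: "(\<lambda>n. F (q n) k) \<longlonglongrightarrow> \<gamma> k" if "(\<lambda>n. clip F (q n)) \<longlonglongrightarrow> \<gamma>" for F \<gamma> k
    proof -
      have "continuous_on UNIV (\<lambda>f :: int \<Rightarrow> real. f k)"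
        by (rule continuous_on_product_coordinates)
      from continuous_on_tendsto_compose[OF this that]
      have "(\<lambda>n. clip F (q n) k) \<longlonglongrightarrow> \<gamma> k" by simp
      moreover have "\<forall>\<^sub>F n in sequentially. clip F (q n) k = F (q n) k"
        using large[of k] by eventually_elim (simp add: clip_def)
      ultimately show ?thesis
        by (rule Lim_transform_eventually)
    qed
    note A = coord[OF clips(1)] and B = coord[OF clips(2)]
    have ev: "\<forall>\<^sub>F n in sequentially. track c (X (q n)) (Y (q n)) (A (q n)) (B (q n)) k" for k
      using large[of k] by eventually_elim (rule tr)
    \<comment> \<open>Each tracking condition is closed and involves finitely many coordinates, so
      it passes to the limit.\<close>
    have "\<exists>s. \<bar>s\<bar> \<le> \<epsilon> \<and> x = \<phi> s y"
    proof (rule exp[OF c])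
      show "\<alpha> 0 = 0" "\<beta> 0 = 0"
        using A[of 0] B[of 0] zero by (simp_all add: LIMSEQ_const_iff)
      fix k
      have dA: "(\<lambda>n. A (q n) (k + 1) - A (q n) k) \<longlonglongrightarrow> \<alpha> (k + 1) - \<alpha> k"
        and dB: "(\<lambda>n. B (q n) (k + 1) - B (q n) k) \<longlonglongrightarrow> \<beta> (k + 1) - \<beta> k"
        by (intro tendsto_intros A B)+
      have dd: "(\<lambda>n. dist (\<phi> (A (q n) k) (X (q n))) (\<phi> (B (q n) k) (Y (q n))))
         \<longlonglongrightarrow> dist (\<phi> (\<alpha> k) x) (\<phi> (\<beta> k) y)"
        by (intro tendsto_intros A B X Y)
      show "c \<le> \<alpha> (k + 1) - \<alpha> k \<and> \<alpha> (k + 1) - \<alpha> k \<le> r"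
        by (intro conjI tendsto_lowerbound[OF dA] tendsto_upperbound[OF dA] eventually_mono[OF ev[of k]])
          (auto simp: track_def)
      show "c \<le> \<beta> (k + 1) - \<beta> k \<and> \<beta> (k + 1) - \<beta> k \<le> r"
        by (intro conjI tendsto_lowerbound[OF dB] tendsto_upperbound[OF dB] eventually_mono[OF ev[of k]])
          (auto simp: track_def)
      show "dist (\<phi> (\<alpha> k) x) (\<phi> (\<beta> k) y) \<le> \<delta>"
        by (intro tendsto_upperbound[OF dd] eventually_mono[OF ev[of k]]) (auto simp: track_def)
    qed
    then obtain s where s: "\<bar>s\<bar> \<le> \<epsilon>" "x = \<phi> s y" by blast
    \<comment> \<open>With \<open>s\<close> kept fixed, the lower bound \<delta>' on the distances
      survives in the limit, where the distance is 0.\<close>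
    have "(\<lambda>n. dist (X (q n)) (\<phi> s (Y (q n)))) \<longlonglongrightarrow> dist x (\<phi> s y)"
      by (intro tendsto_intros X Y)
    then have "\<delta>' \<le> dist x (\<phi> s y)"
      by (rule tendsto_lowerbound) (use far[OF s(1)] in auto)
    then show False
      using s(2) \<delta>' by simp
  qed
  from that[OF r this[unfolded track_def]] show thesis by blast
qed

section \<open>Normalising the time change of a spiral point\<close>

text \<open>The deviation \<open>\<bar>g (t + v) - g t - v\<bar>\<close> starts at 0 and is
  continuous in \<open>v\<close>. To become large it would have to take the value
  \<open>\<eta>'\<close>, but at such a \<open>v\<close> both ends of the two orbit pieces are
  close, and \<open>synchronised\<close> makes the deviation smaller than
  \<open>\<eta>'\<close>.\<close>

lemma reparametrisation_increment:
  assumes per: "aperiodic_upto r0" and "0 < r0" "0 < \<eta>"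
    and g: "continuous_on UNIV g" "((\<lambda>t. dist (\<phi> t x) (\<phi> (g t) x)) \<longlongrightarrow> 0) at_top"
  obtains T where "0 \<le> T"
    "\<And>t u. \<lbrakk>T \<le> t; 0 \<le> u; u \<le> r0 / 4\<rbrakk> \<Longrightarrow> \<bar>g (t + u) - g t - u\<bar> < \<eta>"
proof -
  \<comment> \<open>The cap \<open>r0 / 4\<close> keeps \<open>g (t + v) - g t\<close> within the
    range \<open>r0 / 2\<close> of \<open>synchronised\<close>.\<close>
  define \<eta>' where "\<eta>' = min \<eta> (r0 / 4)"
  have "0 < \<eta>'" using assms by (simp add: \<eta>'_def)
  then obtain \<delta> where \<delta>: "0 < \<delta>"
    "\<And>p q u v. \<lbrakk>\<bar>u\<bar> \<le> r0 / 2; \<bar>v\<bar> \<le> r0 / 2; dist p q \<le> \<delta>; dist (\<phi> u p) (\<phi> v q) \<le> \<delta>\<rbrakk>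
      \<Longrightarrow> \<bar>u - v\<bar> < \<eta>'"
    using synchronised[OF per] by blast
  from tendstoD[OF g(2) \<delta>(1)] obtain T where
    T: "\<And>t. T \<le> t \<Longrightarrow> dist (\<phi> t x) (\<phi> (g t) x) < \<delta>"
    by (auto simp: eventually_at_top_linorder)
  show thesis
  proof (rule that[of "max 0 T"])
    fix t u assume t: "max 0 T \<le> t" and u: "0 \<le> u" "u \<le> r0 / 4"
    define f where "f v = \<bar>g (t + v) - g t - v\<bar>" for v
    have "f u < \<eta>'"
    proof (rule ccontr)
      assume "\<not> f u < \<eta>'"
      then have "f 0 \<le> \<eta>'" "\<eta>' \<le> f u"
        using \<open>0 < \<eta>'\<close> by (auto simp: f_def)
      moreover have "continuous_on {0..u} f"
        unfolding f_def by (intro continuous_intros continuous_on_compose2[OF g(1)]) auto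
      ultimately obtain v where v: "0 \<le> v" "v \<le> u" "f v = \<eta>'"
        using IVT'[of f 0 \<eta>' u] u(1) by blast
      have "\<bar>v - (g (t + v) - g t)\<bar> < \<eta>'"
      proof (rule \<delta>(2)[of _ _ "\<phi> t x" "\<phi> (g t) x"])
        show "\<bar>v\<bar> \<le> r0 / 2" using v u by linarith
        show "\<bar>g (t + v) - g t\<bar> \<le> r0 / 2"
        proof -
          have "\<bar>g (t + v) - g t - v\<bar> \<le> r0 / 4"
            using v(3) by (simp add: f_def \<eta>'_def)
          then show ?thesis using v u by linarith
        qed
        show "dist (\<phi> t x) (\<phi> (g t) x) \<le> \<delta>"
          using T[of t] t by simp
        show "dist (\<phi> v (\<phi> t x)) (\<phi> (g (t + v) - g t) (\<phi> (g t) x)) \<le> \<delta>"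
          using T[of "t + v"] t v by (simp add: flow_add)
      qed
      then show False using v(3) by (simp add: f_def abs_minus_commute)
    qed
    then show "\<bar>g (t + u) - g t - u\<bar> < \<eta>"
      by (simp add: f_def \<eta>'_def)
  qed simp
qed

text \<open>\<open>G\<close> interpolates \<open>g\<close> linearly on a grid of mesh \<rho>. Late
  increments of \<open>g\<close> over one mesh are close to \<rho>, so the interpolation increases;
  their deviation from \<rho> tends to 0, so \<open>G - g\<close> tends to 0 and the asymptotic
  condition is kept.\<close>

lemma spiral_homeomorphism:
  assumes "spiral_point \<phi> x"
  obtains \<tau> G G' where "0 < \<tau>" "homeomorphism UNIV UNIV G G'" "strict_mono G"
    "\<And>t. t + \<tau> < G t" "((\<lambda>t. dist (\<phi> t x) (\<phi> (G t) x)) \<longlongrightarrow> 0) at_top"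
proof -
  obtain \<tau> g where \<tau>: "0 < \<tau>" and g: "continuous_on UNIV g" "\<And>t. 0 \<le> t \<Longrightarrow> \<tau> + t < g t"
    and lim: "((\<lambda>t. dist (\<phi> t x) (\<phi> (g t) x)) \<longlongrightarrow> 0) at_top"
    using assms unfolding spiral_point_def by blast
  obtain r0 where r0: "0 < r0" "aperiodic_upto r0"
    using no_short_period by blast
  define \<rho> where "\<rho> = r0 / 4"
  have \<rho>: "0 < \<rho>" using r0 by (simp add: \<rho>_def)
  note incr = reparametrisation_increment[OF r0(2) r0(1) _ g(1) lim, folded \<rho>_def]
  obtain T where T: "0 \<le> T"
    "\<And>t u. \<lbrakk>T \<le> t; 0 \<le> u; u \<le> \<rho>\<rbrakk> \<Longrightarrow> \<bar>g (t + u) - g t - u\<bar> < \<rho> / 2"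
    using incr[OF half_gt_zero[OF \<rho>]] by blast
  define K where "K = \<lceil>T / \<rho>\<rceil>"
  have "T / \<rho> \<le> of_int K" unfolding K_def by simp
  then have K: "T \<le> \<rho> * of_int K"
    using \<rho> by (simp add: field_simps)
  \<comment> \<open>Before the index \<open>K\<close>, where the increments of \<open>g\<close> are
    not controlled, the sequence continues with slope one. This keeps the gap \<tau> at every node,
    including those at negative times.\<close>
  define a where "a k = g (\<rho> * of_int (max k K)) + \<rho> * of_int (min (k - K) 0)" for k
  have a_ge: "a k = g (\<rho> * of_int k)" if "K \<le> k" for k
    using that by (simp add: a_def)
  have inc: "\<bar>a (k + 1) - a k - \<rho>\<bar> < \<rho> / 2" for k
  proof (cases "K \<le> k")
    case True
    then have "T \<le> \<rho> * of_int k"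
      using K \<rho> by (smt (verit) mult_left_mono of_int_le_iff)
    from T(2)[OF this, of \<rho>] \<rho> True show ?thesis
      by (simp add: a_ge algebra_simps)
  next
    case False
    then show ?thesis using \<rho> by (simp add: a_def max_def algebra_simps)
  qed
  have inc2: "\<rho> / 2 \<le> a (k + 1) - a k" "a (k + 1) - a k \<le> 2 * \<rho>" for k
    using inc[of k] \<rho> by linarith+
  obtain gi where gi: "homeomorphism UNIV UNIV (interp a) gi" "strict_mono (interp a)"
    using interp_homeomorphism[of "\<rho> / 2" a "2 * \<rho>", OF _ inc2] \<rho> half_gt_zero by blast
  define G where "G t = interp a (t / \<rho>)" for t
  have "homeomorphism UNIV UNIV (\<lambda>t. t / \<rho>) (\<lambda>t. \<rho> * t)"
    using \<rho> by (intro homeomorphismI continuous_intros) auto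
  from homeomorphism_compose[OF this gi(1)]
  have "homeomorphism UNIV UNIV G ((\<lambda>t. \<rho> * t) \<circ> gi)"
    by (simp add: G_def[abs_def] o_def)
  moreover have "strict_mono G"
    using gi(2) \<rho> by (auto simp: strict_mono_def G_def divide_strict_right_mono)
  moreover have "t + \<tau> < G t" for t
  proof -
    have "\<rho> * of_int k + \<tau> < a k" for k
    proof -
      have "0 \<le> \<rho> * of_int (max k K)"
        using T(1) K \<rho> by (smt (verit) max.cobounded2 mult_left_mono of_int_le_iff)
      from g(2)[OF this] have "\<tau> + \<rho> * (of_int (max k K) + of_int (min (k - K) 0)) < a k"
        by (simp add: a_def algebra_simps)
      also have "of_int (max k K) + of_int (min (k - K) 0) = (of_int k :: real)"
        by (simp add: max_def min_def)
      finally show ?thesis by simp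
    qed
    from interp_gt[of \<rho> \<tau> a "t / \<rho>", OF this] show ?thesis
      using \<rho> by (simp add: G_def)
  qed
  moreover have "((\<lambda>t. dist (\<phi> t x) (\<phi> (G t) x)) \<longlongrightarrow> 0) at_top"
  proof (rule tendstoI)
    fix e :: real assume "0 < e"
    then obtain r where r: "0 < r" "\<And>s p. \<bar>s\<bar> \<le> r \<Longrightarrow> dist (\<phi> s p) p < e / 2"
      using flow_short_time[of "e / 2"] by auto
    obtain T1 where "0 \<le> T1" and T1: "\<And>t u. \<lbrakk>T1 \<le> t; 0 \<le> u; u \<le> \<rho>\<rbrakk> \<Longrightarrow> \<bar>g (t + u) - g t - u\<bar> < r / 2"
      using incr[OF half_gt_zero[OF r(1)]] by blast
    have "\<forall>\<^sub>F t in at_top. dist (\<phi> t x) (\<phi> (g t) x) < e / 2"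
      using tendstoD[OF lim, of "e / 2"] \<open>0 < e\<close> by simp
    then show "\<forall>\<^sub>F t in at_top. dist (dist (\<phi> t x) (\<phi> (G t) x)) 0 < e"
      using eventually_ge_at_top[of "\<rho> * of_int K"] eventually_ge_at_top[of "T1 + \<rho>"]
    proof eventually_elim
      case (elim t)
      define k where "k = \<lfloor>t / \<rho>\<rfloor>"
      define u where "u = t - \<rho> * of_int k"
      have u: "0 \<le> u" "u \<le> \<rho>"
        using floor_divide_lower[OF \<rho>, of t] floor_divide_upper[OF \<rho>, of t]
        by (simp_all add: u_def k_def algebra_simps)
      have "K \<le> k"
        unfolding k_def using elim(2) \<rho> by (simp add: le_floor_iff field_simps)
      have "T1 \<le> \<rho> * of_int k"
        using elim(3) u by (simp add: u_def)
      from T1[OF this u] T1[OF this, of \<rho>] \<rho> \<open>K \<le> k\<close>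
      have g1: "\<bar>g t - a k - u\<bar> < r / 2" and a1: "\<bar>a (k + 1) - a k - \<rho>\<bar> < r / 2"
        by (simp_all add: a_ge u_def algebra_simps)
      \<comment> \<open>On a grid cell the deviation of \<open>G\<close> from unit speed is the
        fraction \<open>u / \<rho>\<close> of its value at the right end.\<close>
      have "G t - a k - u = (u / \<rho>) * (a (k + 1) - a k - \<rho>)"
        using \<rho> by (simp add: G_def interp_def k_def[symmetric] u_def field_simps)
      also have "\<bar>\<dots>\<bar> \<le> 1 * \<bar>a (k + 1) - a k - \<rho>\<bar>"
        unfolding abs_mult using u \<rho> by (intro mult_right_mono) auto
      finally have "\<bar>G t - a k - u\<bar> < r / 2"
        using a1 by simp
      then have "\<bar>g t - G t\<bar> \<le> r"
        using g1 by linarith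
      from r(2)[OF this, of "\<phi> (G t) x"] have "dist (\<phi> (g t) x) (\<phi> (G t) x) < e / 2"
        by (simp add: flow_add)
      then show ?case
        using elim(1) dist_triangle[of "\<phi> t x" "\<phi> (G t) x" "\<phi> (g t) x"] by simp
    qed
  qed
  ultimately show thesis
    using that[of \<tau> G] \<tau> by blast
qed

end

section \<open>Shadowing of a loop by later loops\<close>

locale spiral_flow = compact_regular_flow \<phi>
  for \<phi> :: "real \<Rightarrow> 'a::metric_space \<Rightarrow> 'a" +
  fixes x :: 'a and G G' :: "real \<Rightarrow> real" and \<tau> :: real
  assumes \<tau>: "0 < \<tau>"
    and homeo: "homeomorphism UNIV UNIV G G'"
    and G_mono: "strict_mono G"
    and G_gt: "t + \<tau> < G t"
    and asymptotic: "((\<lambda>t. dist (\<phi> t x) (\<phi> (G t) x)) \<longlongrightarrow> 0) at_top"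
    and expansive: "expansive_flow \<phi>"
begin

lemma G_inverse [simp]: "G (G' t) = t"
  using homeo by (simp add: homeomorphism_def)

lemma G_ge: "t \<le> G t"
  using G_gt[of t] \<tau> by linarith

lemma G_le_iff [simp]: "G s \<le> G t \<longleftrightarrow> s \<le> t"
  by (rule strict_mono_less_eq[OF G_mono])

lemma funpow_G_ge: "t \<le> (G ^^ n) t"
  by (induction n) (auto intro: order_trans G_ge)

lemma funpow_G_le_iff [simp]: "(G ^^ n) s \<le> (G ^^ n) t \<longleftrightarrow> s \<le> t"
  by (induction n) auto

section \<open>Propagating estimates from one loop to its neighbours\<close>

text \<open>The second alternative serves for going back one loop, where only the image increment is
  known to be small: if \<open>q - p\<close> exceeded \<open>r0 / 4\<close>, monotonicity would
  force \<open>G q - G p\<close> above \<open>r0 / 8\<close>.\<close>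

lemma G_increment:
  assumes per: "aperiodic_upto r0" and "0 < r0" "0 < \<eta>" "\<eta> \<le> r0 / 8"
  obtains T where
    "\<And>p q. \<lbrakk>T \<le> p; p \<le> q; q - p \<le> r0 / 4 \<or> G q - G p \<le> r0 / 8\<rbrakk> \<Longrightarrow> \<bar>G q - G p - (q - p)\<bar> < \<eta>"
proof -
  have "continuous_on UNIV G"
    using homeo by (simp add: homeomorphism_def)
  from reparametrisation_increment[OF per assms(2,3) this asymptotic]
  obtain T where T: "\<And>t u. \<lbrakk>T \<le> t; 0 \<le> u; u \<le> r0 / 4\<rbrakk> \<Longrightarrow> \<bar>G (t + u) - G t - u\<bar> < \<eta>"
    by blast
  show thesis
  proof (rule that[of T])
    fix p q assume h: "T \<le> p" "p \<le> q" "q - p \<le> r0 / 4 \<or> G q - G p \<le> r0 / 8"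
    have "q - p \<le> r0 / 4"
    proof (rule ccontr)
      assume "\<not> ?thesis"
      then have "G (p + r0 / 4) \<le> G q" "G q - G p \<le> r0 / 8"
        using h(3) by auto
      then show False
        using T[OF h(1), of "r0 / 4"] assms(2,4) by linarith
    qed
    then show "\<bar>G q - G p - (q - p)\<bar> < \<eta>"
      using T[OF h(1), of "q - p"] h(2) by simp
  qed
qed

text \<open>Passing to the next or previous loop changes an increment by less than \<eta>. The
  bounds involving \<open>R\<close> keep all increments within the range of \<open>incG\<close> for
  up to \<open>L\<close> passages.\<close>

lemma increments_extend:
  fixes N :: int and F :: "int \<Rightarrow> real"
  assumes N: "0 < N" and F: "\<And>k. F (k + N) = G (F k)"
    and late: "\<And>k. - int L * N \<le> k \<Longrightarrow> lo \<le> F k"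
    and incG: "\<And>p q. \<lbrakk>lo \<le> p; p \<le> q; q - p \<le> 2 * R \<or> G q - G p \<le> R\<rbrakk> \<Longrightarrow> \<bar>G q - G p - (q - p)\<bar> < \<eta>"
    and base: "\<And>k. 0 \<le> k \<Longrightarrow> k < N \<Longrightarrow> \<bar>F (k + 1) - F k - \<rho>\<bar> \<le> \<beta>"
    and small: "0 < \<eta>" "\<beta> + real L * \<eta> \<le> \<rho>" "\<rho> + \<beta> + real L * \<eta> \<le> R"
    and k: "- int L * N \<le> k" "k < (int L + 1) * N"
  shows "\<bar>F (k + 1) - F k - \<rho>\<bar> \<le> \<beta> + real L * \<eta>"
proof -
  have sm: "\<bar>F (k + 1) - F k - \<rho>\<bar> \<le> \<beta> + real n * \<eta> \<Longrightarrow> n < L \<Longrightarrow>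
      0 \<le> F (k + 1) - F k \<and> F (k + 1) - F k \<le> R" for n k
  proof -
    assume h: "\<bar>F (k + 1) - F k - \<rho>\<bar> \<le> \<beta> + real n * \<eta>" "n < L"
    have "real n * \<eta> \<le> real L * \<eta>"
      using h(2) small(1) by simp
    then show ?thesis using h(1) small(2,3) by linarith
  qed
  have F1: "F (k + 1 + N) = G (F (k + 1))" for k
    using F[of "k + 1"] by simp
  show ?thesis
  proof (rule loop_induct[of N "\<lambda>n k. \<bar>F (k + 1) - F k - \<rho>\<bar> \<le> \<beta> + real n * \<eta>" L L k, OF N])
    fix n k assume h: "\<bar>F (k + 1) - F k - \<rho>\<bar> \<le> \<beta> + real n * \<eta>"
    then show "\<bar>F (k + 1) - F k - \<rho>\<bar> \<le> \<beta> + real (Suc n) * \<eta>"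
      using small(1) by (simp add: algebra_simps)
    assume n: "n < L" and k: "- int L * N \<le> k"
    have "\<bar>G (F (k + 1)) - G (F k) - (F (k + 1) - F k)\<bar> < \<eta>"
      using sm[OF h n] by (intro incG late[OF k]) auto
    then show "\<bar>F (k + N + 1) - F (k + N) - \<rho>\<bar> \<le> \<beta> + real (Suc n) * \<eta>"
      using h F[of k] F1[of k] by (simp add: algebra_simps)
  next
    fix n k assume n: "n < L" and k: "- int L * N \<le> k"
      and h: "\<bar>F (k + N + 1) - F (k + N) - \<rho>\<bar> \<le> \<beta> + real n * \<eta>"
    have e: "F (k + N + 1) - F (k + N) = G (F (k + 1)) - G (F k)"
      using F[of k] F1[of k] by (simp add: algebra_simps)
    have "F k \<le> F (k + 1)" "G (F (k + 1)) - G (F k) \<le> R"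
      using sm[OF h n] unfolding e by simp_all
    then have "\<bar>G (F (k + 1)) - G (F k) - (F (k + 1) - F k)\<bar> < \<eta>"
      by (intro incG late[OF k]) auto
    then show "\<bar>F (k + 1) - F k - \<rho>\<bar> \<le> \<beta> + real (Suc n) * \<eta>"
      using h unfolding e by (simp add: algebra_simps)
  qed (use base k in auto)
qed

text \<open>Applying \<open>G\<close> to both times moves each of the two points by at most
  \<open>e\<close>, so every passage between loops costs \<open>2 * e\<close>.\<close>

lemma distances_extend:
  fixes N :: int and F H :: "int \<Rightarrow> real"
  assumes N: "0 < N" and F: "\<And>k. F (k + N) = G (F k)" and H: "\<And>k. H (k + N) = G (H k)"
    and late: "\<And>k. - int L * N \<le> k \<Longrightarrow> lo \<le> F k" "\<And>k. - int L * N \<le> k \<Longrightarrow> lo \<le> H k"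
    and close: "\<And>t. lo \<le> t \<Longrightarrow> dist (\<phi> t x) (\<phi> (G t) x) \<le> e"
    and base: "\<And>k. 0 \<le> k \<Longrightarrow> k < N \<Longrightarrow> dist (\<phi> (F k) x) (\<phi> (H k) x) \<le> \<alpha>"
    and k: "- int L * N \<le> k" "k < (int L + 1) * N"
  shows "dist (\<phi> (F k) x) (\<phi> (H k) x) \<le> \<alpha> + real L * (2 * e)"
proof -
  have "0 \<le> e"
    using close[of lo] zero_le_dist by (meson order_refl order_trans)
  have shift: "\<bar>dist (\<phi> (F (k + N)) x) (\<phi> (H (k + N)) x) - dist (\<phi> (F k) x) (\<phi> (H k) x)\<bar> \<le> 2 * e"
    if "- int L * N \<le> k" for k
    using close[OF late(1)[OF that]] close[OF late(2)[OF that]]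
      dist_triangle[of "\<phi> (F k) x" "\<phi> (H k) x" "\<phi> (F (k + N)) x"]
      dist_triangle[of "\<phi> (F (k + N)) x" "\<phi> (H k) x" "\<phi> (H (k + N)) x"]
      dist_triangle[of "\<phi> (F (k + N)) x" "\<phi> (H (k + N)) x" "\<phi> (F k) x"]
      dist_triangle[of "\<phi> (F k) x" "\<phi> (H (k + N)) x" "\<phi> (H k) x"]
    by (simp add: F H dist_commute)
  show ?thesis
  proof (rule loop_induct[of N "\<lambda>n k. dist (\<phi> (F k) x) (\<phi> (H k) x) \<le> \<alpha> + real n * (2 * e)" L L k, OF N])
    fix n k assume h: "dist (\<phi> (F k) x) (\<phi> (H k) x) \<le> \<alpha> + real n * (2 * e)"
    then show "dist (\<phi> (F k) x) (\<phi> (H k) x) \<le> \<alpha> + real (Suc n) * (2 * e)"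
      using \<open>0 \<le> e\<close> by (simp add: algebra_simps)
    assume "- int L * N \<le> k"
    from shift[OF this] h
    show "dist (\<phi> (F (k + N)) x) (\<phi> (H (k + N)) x) \<le> \<alpha> + real (Suc n) * (2 * e)"
      by (simp add: algebra_simps abs_le_iff)
  next
    fix n k assume h: "- int L * N \<le> k" "dist (\<phi> (F (k + N)) x) (\<phi> (H (k + N)) x) \<le> \<alpha> + real n * (2 * e)"
    from shift[OF h(1)] h(2)
    show "dist (\<phi> (F k) x) (\<phi> (H k) x) \<le> \<alpha> + real (Suc n) * (2 * e)"
      by (simp add: algebra_simps abs_le_iff)
  qed (use base k in auto)
qed

text \<open>Starting times of later loops that shadow the loop starting at \<open>T\<close>. The
  bound \<open>C\<close> does not depend on \<open>m\<close>; the upper bound on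
  \<open>c (Suc m)\<close> prevents the chain from jumping far beyond a given time.\<close>

definition return_chain :: "real \<Rightarrow> real \<Rightarrow> real \<Rightarrow> (nat \<Rightarrow> real) \<Rightarrow> bool" where
  "return_chain \<delta> T C c \<longleftrightarrow> c 0 = T \<and> (\<forall>m. c m + \<tau> / 2 \<le> c (Suc m) \<and> c (Suc m) \<le> G (c m) + \<tau> \<and>
     G (c m) - c m \<le> C \<and> dist (\<phi> T x) (\<phi> (c m) x) \<le> \<delta>)"

text \<open>From a loop tracking the first one, \<open>G\<close> gives a later loop that tracks
  slightly worse; \<open>uniform_expansive\<close> restores the accuracy by small time shifts, so
  errors do not accumulate. Every tracking loop is cut into the same number \<open>N\<close> of
  steps of nearly the same length, which bounds its length.\<close>

lemma shadowing_chain: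
  assumes "0 < \<delta>"
  shows "\<exists>T1. \<forall>T\<ge>T1. \<exists>C c. return_chain \<delta> T C c"
proof -
  obtain r0 where r0: "0 < r0" "aperiodic_upto r0"
    using no_short_period by blast
  \<comment> \<open>Shifts up to \<epsilon> stay in the range of the increment estimate and undo at
    most half of the advance \<tau>.\<close>
  define \<epsilon> where "\<epsilon> = min (r0 / 16) (\<tau> / 2)"
  have \<epsilon>: "0 < \<epsilon>" "\<epsilon> \<le> r0 / 16" "\<epsilon> \<le> \<tau> / 2"
    using r0 \<tau> by (auto simp: \<epsilon>_def)
  obtain r1 \<delta>1 where r1: "0 < r1" "0 < \<delta>1" and uniform:
    "\<And>c \<delta>'. \<lbrakk>0 < c; 0 < \<delta>'\<rbrakk> \<Longrightarrow> \<exists>L. \<forall>x y a b. a 0 = 0 \<and> b 0 = 0 \<and>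
       (\<forall>k::int. \<bar>k\<bar> \<le> int L \<longrightarrow> c \<le> a (k + 1) - a k \<and> a (k + 1) - a k \<le> r1 \<and>
          c \<le> b (k + 1) - b k \<and> b (k + 1) - b k \<le> r1 \<and>
          dist (\<phi> (a k) x) (\<phi> (b k) y) \<le> \<delta>1) \<longrightarrow>
       (\<exists>s. \<bar>s\<bar> \<le> \<epsilon> \<and> dist x (\<phi> s y) < \<delta>')"
    using uniform_expansive[OF expansive \<epsilon>(1)] by blast
  \<comment> \<open>The unit of the time grid: steps \<rho> will lie between
    \<open>8 * \<eta>\<close> and \<open>16 * \<eta>\<close>, so an error of
    \<open>3 * \<eta>\<close> leaves them between \<open>4 * \<eta>\<close> and \<open>r1\<close>,
    and below \<open>r0 / 8\<close>.\<close>
  define \<eta> where "\<eta> = min (r1 / 32) (min (r0 / 256) (\<tau> / 16))"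
  have \<eta>: "0 < \<eta>" "32 * \<eta> \<le> r1" "256 * \<eta> \<le> r0" "16 * \<eta> \<le> \<tau>"
    using r0 r1 \<tau> by (auto simp: \<eta>_def min_def)
  obtain \<delta>2 where \<delta>2: "0 < \<delta>2"
    "\<And>p q u v. \<lbrakk>\<bar>u\<bar> \<le> r0 / 2; \<bar>v\<bar> \<le> r0 / 2; dist p q \<le> \<delta>2; dist (\<phi> u p) (\<phi> v q) \<le> \<delta>2\<rbrakk>
      \<Longrightarrow> \<bar>u - v\<bar> < \<eta>"
    using synchronised[OF r0(2) \<eta>(1)] by blast
  define \<delta>0 where "\<delta>0 = min \<delta> (min \<delta>1 \<delta>2) / 2"
  have \<delta>0: "0 < \<delta>0" "2 * \<delta>0 \<le> \<delta>" "2 * \<delta>0 \<le> \<delta>1" "2 * \<delta>0 \<le> \<delta>2"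
    using assms r1 \<delta>2 by (auto simp: \<delta>0_def)
  obtain L where L: "\<And>x y a b. \<lbrakk>a 0 = 0; b 0 = 0; \<And>k::int. \<bar>k\<bar> \<le> int L \<Longrightarrow>
        4 * \<eta> \<le> a (k + 1) - a k \<and> a (k + 1) - a k \<le> r1 \<and>
        4 * \<eta> \<le> b (k + 1) - b k \<and> b (k + 1) - b k \<le> r1 \<and>
        dist (\<phi> (a k) x) (\<phi> (b k) y) \<le> \<delta>1\<rbrakk> \<Longrightarrow> \<exists>s. \<bar>s\<bar> \<le> \<epsilon> \<and> dist x (\<phi> s y) < \<delta>0 / 2"
    using uniform[of "4 * \<eta>" "\<delta>0 / 2"] \<eta>(1) \<delta>0(1) by (metis half_gt_zero mult_pos_pos zero_less_numeral)
  \<comment> \<open>The costs per loop, \<open>\<eta>'\<close> for increments and \<open>e\<close>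
    for distances, are so small that \<open>L\<close> passages add at most \<eta> and keep the total
    distance below \<open>2 * \<delta>0\<close>.\<close>
  define \<eta>' where "\<eta>' = \<eta> / (real L + 2)"
  have \<eta>': "0 < \<eta>'" "\<eta>' \<le> \<eta>" "real L * \<eta>' \<le> \<eta>"
    using \<eta>(1) by (auto simp: \<eta>'_def field_simps)
  define e where "e = \<delta>0 / (4 * (real L + 2))"
  have "0 < e"
    using \<delta>0(1) by (simp add: e_def)
  moreover have "e * (4 * (real L + 2)) = \<delta>0"
    unfolding e_def by (simp add: add_nonneg_eq_0_iff)
  then have "4 * (real L * e) + 8 * e = \<delta>0"
    by (simp add: algebra_simps)
  moreover have "0 \<le> real L * e"
    using \<open>0 < e\<close> by simp
  ultimately have e: "0 < e" "e + real L * (2 * e) \<le> \<delta>0" "2 * e \<le> \<delta>0 / 2"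
    by linarith+
  have "\<eta>' \<le> r0 / 8"
    using \<eta>' \<eta> by linarith
  obtain Ti where Ti: "\<And>p q. \<lbrakk>Ti \<le> p; p \<le> q; q - p \<le> r0 / 4 \<or> G q - G p \<le> r0 / 8\<rbrakk>
      \<Longrightarrow> \<bar>G q - G p - (q - p)\<bar> < \<eta>'"
    using G_increment[OF r0(2,1) \<eta>'(1) \<open>\<eta>' \<le> r0 / 8\<close>] by blast
  from tendstoD[OF asymptotic e(1)] obtain Td where
    Td: "\<And>t. Td \<le> t \<Longrightarrow> dist (\<phi> t x) (\<phi> (G t) x) < e"
    by (auto simp: eventually_at_top_linorder)
  define T0 where "T0 = max Ti Td"
  have incG: "\<And>p q. \<lbrakk>T0 \<le> p; p \<le> q; q - p \<le> 2 * (r0 / 8) \<or> G q - G p \<le> r0 / 8\<rbrakk>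
      \<Longrightarrow> \<bar>G q - G p - (q - p)\<bar> < \<eta>'"
    by (rule Ti) (auto simp: T0_def)
  have close: "dist (\<phi> t x) (\<phi> (G t) x) \<le> e" if "T0 \<le> t" for t
    using Td[of t] that by (simp add: T0_def less_imp_le)
  show ?thesis
  \<comment> \<open>Starting after \<open>(G ^^ L) T0\<close> leaves room for \<open>L\<close> loops
    backwards before time \<open>T0\<close>.\<close>
  proof (rule exI[of _ "(G ^^ L) T0"], intro allI impI)
    fix T assume T: "(G ^^ L) T0 \<le> T"
    \<comment> \<open>The loop is longer than \<open>16 * \<eta>\<close>, so rounding up at most
      doubles the quotient; this gives \<open>8 * \<eta> \<le> \<rho>\<close>.\<close>
    define N where "N = \<lceil>(G T - T) / (16 * \<eta>)\<rceil>"
    define \<rho> where "\<rho> = (G T - T) / of_int N"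
    have "16 * \<eta> < G T - T"
      using G_gt[of T] \<eta>(4) by linarith
    then have "1 < (G T - T) / (16 * \<eta>)"
      using \<eta>(1) by simp
    then have N: "0 < N" "(G T - T) / (16 * \<eta>) \<le> of_int N" "of_int N \<le> 2 * ((G T - T) / (16 * \<eta>))"
      unfolding N_def by linarith+
    have \<rho>: "8 * \<eta> \<le> \<rho>" "\<rho> \<le> 16 * \<eta>" "of_int N * \<rho> = G T - T"
      using N \<eta>(1) by (auto simp: \<rho>_def field_simps)
    obtain t where t: "\<And>k. 0 \<le> k \<Longrightarrow> k < N \<Longrightarrow> t k = T + of_int k * \<rho>" "\<And>k. t (k + N) = G (t k)"
      using equivariant_extension[of G G' N "\<lambda>k. T + of_int k * \<rho>"] N(1) by auto
    have t0: "t 0 = T" and tN: "t N = T + of_int N * \<rho>"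
      using t(1)[of 0] t(2)[of 0] N(1) \<rho>(3) by simp_all
    have t_inc: "t (k + 1) - t k = \<rho>" if "0 \<le> k" "k < N" for k
      using t(1)[of k] t(1)[of "k + 1"] tN that by (cases "k + 1 = N") (auto simp: algebra_simps)
    have t_ge: "T \<le> t k" if "0 \<le> k" for k
    proof -
      have "0 \<le> of_int (k mod N) * \<rho>"
        using N(1) \<rho>(1) \<eta>(1) by (intro mult_nonneg_nonneg) auto
      then have "T \<le> t (k mod N)"
        using t(1)[of "k mod N"] N(1) by simp
      also have "\<dots> \<le> (G ^^ nat (k div N)) (t (k mod N))"
        by (rule funpow_G_ge)
      also have "\<dots> = t (k mod N + int (nat (k div N)) * N)"
        by (rule equivariant_funpow[symmetric, where F = t and G = G]) (rule t(2))
      also have "k mod N + int (nat (k div N)) * N = k"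
        using that N(1) by (simp add: pos_imp_zdiv_nonneg_iff)
      finally show ?thesis .
    qed
    have t_late: "T0 \<le> t k" if "- int L * N \<le> k" for k
    proof -
      have "(G ^^ L) T0 \<le> t (k + int L * N)"
        using t_ge[of "k + int L * N"] that T by simp
      also have "\<dots> = (G ^^ L) (t k)"
        by (rule equivariant_funpow[where F = t and G = G]) (rule t(2))
      finally show ?thesis by simp
    qed
    have window: "- int L * N \<le> k + i \<and> k + i < (int L + 1) * N"
      if "0 \<le> k" "k < N" "\<bar>i\<bar> \<le> int L" for k i
    proof -
      have "int L * 1 \<le> int L * N"
        using N(1) by (intro mult_left_mono) auto
      then show ?thesis using that by (simp add: algebra_simps abs_le_iff)
    qed
    have spread: "\<bar>F (k + 1) - F k - \<rho>\<bar> \<le> 3 * \<eta>"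
      if "\<And>k. F (k + N) = G (F k)" "\<And>k. t k \<le> F k"
        "\<And>k. 0 \<le> k \<Longrightarrow> k < N \<Longrightarrow> \<bar>F (k + 1) - F k - \<rho>\<bar> \<le> 2 * \<eta>"
        "- int L * N \<le> k" "k < (int L + 1) * N" for F k
    proof -
      have "\<bar>F (k + 1) - F k - \<rho>\<bar> \<le> 2 * \<eta> + real L * \<eta>'"
      proof (rule increments_extend[where lo = T0 and R = "r0 / 8" and N = N and L = L])
        show "T0 \<le> F k" if "- int L * N \<le> k" for k
          using t_late[OF that] \<open>t k \<le> F k\<close> by linarith
      qed (use that N(1) incG \<eta> \<eta>' \<rho> in auto)
      then show ?thesis using \<eta>'(3) by linarith
    qed
    \<comment> \<open>Expansivity corrects \<open>A\<close> by unrelated time shifts at each \<open>k\<close> in one loop only; equivariance then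
      defines the corrected sequence everywhere, and \<open>\<delta>2\<close> recovers the control of the increments.\<close>
    define good where "good A \<longleftrightarrow> (\<forall>k. A (k + N) = G (A k)) \<and> (\<forall>k. t k \<le> A k) \<and>
       (\<forall>k. 0 \<le> k \<and> k < N \<longrightarrow> dist (\<phi> (t k) x) (\<phi> (A k) x) \<le> \<delta>0 \<and>
           \<bar>A (k + 1) - A k - \<rho>\<bar> \<le> \<eta>)" for A
    have good_t: "good t"
      using \<delta>0(1) \<eta>(1) by (auto simp: good_def t(2) t_inc)

    \<comment> \<open>One correction step\<close>
    have step: "\<exists>A'. good A' \<and> A 0 + \<tau> / 2 \<le> A' 0 \<and> A' 0 \<le> G (A 0) + \<tau>" if "good A" for A
    proof -
      have A: "\<And>k. A (k + N) = G (A k)" "\<And>k. t k \<le> A k"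
        "\<And>k. 0 \<le> k \<Longrightarrow> k < N \<Longrightarrow> dist (\<phi> (t k) x) (\<phi> (A k) x) \<le> \<delta>0"
        "\<And>k. 0 \<le> k \<Longrightarrow> k < N \<Longrightarrow> \<bar>A (k + 1) - A k - \<rho>\<bar> \<le> \<eta>"
        using that by (auto simp: good_def)
      define B where "B k = G (A k)" for k
      have late0: "T0 \<le> t k" if "0 \<le> k" for k
      proof -
        have "0 \<le> int L * N" using N(1) by simp
        then show ?thesis using t_late[of k] that by simp
      qed
      have B: "B (k + N) = G (B k)" "t k \<le> B k" "A k + \<tau> \<le> B k" for k
        using A(1)[of k] A(2)[of k] G_ge[of "A k"] G_gt[of "A k"] by (simp_all add: B_def)
      have B_dist: "dist (\<phi> (t k) x) (\<phi> (B k) x) \<le> \<delta>0 + e" if "0 \<le> k" "k < N" for k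
        using A(3)[OF that] close[of "A k"] late0[OF that(1)] A(2)[of k]
          dist_triangle[of "\<phi> (t k) x" "\<phi> (B k) x" "\<phi> (A k) x"] by (simp add: B_def)
      have B_inc: "\<bar>B (k + 1) - B k - \<rho>\<bar> \<le> 2 * \<eta>" if "0 \<le> k" "k < N" for k
      proof -
        have "\<bar>B (k + 1) - B k - (A (k + 1) - A k)\<bar> < \<eta>'"
          unfolding B_def using A(4)[OF that] late0[OF that(1)] A(2)[of k] \<rho> \<eta> r0(1)
          by (intro incG) linarith+
        then show ?thesis using A(4)[OF that] \<eta>'(2) by linarith
      qed
      \<comment> \<open>For each \<open>k\<close> in the base loop, expansivity is applied on the
        window of \<open>L\<close> samples around \<open>k\<close>, all of which lie within
        \<open>L\<close> loops of the base loop.\<close>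
      have "\<exists>s. \<bar>s\<bar> \<le> \<epsilon> \<and> dist (\<phi> (t k) x) (\<phi> s (\<phi> (B k) x)) < \<delta>0 / 2" if k: "0 \<le> k" "k < N" for k
      proof (rule L[of "\<lambda>i. t (k + i) - t k" "\<lambda>i. B (k + i) - B k"])
        fix i assume i: "\<bar>i\<bar> \<le> int L"
        have w: "- int L * N \<le> k + i" "k + i < (int L + 1) * N"
          using window[OF k i] by auto
        have "\<bar>t (k + i + 1) - t (k + i) - \<rho>\<bar> \<le> 3 * \<eta>"
          by (rule spread) (use w \<eta>(1) in \<open>auto simp: t(2) t_inc\<close>)
        moreover have "\<bar>B (k + i + 1) - B (k + i) - \<rho>\<bar> \<le> 3 * \<eta>"
          by (rule spread) (use w B B_inc in auto)
        moreover have "dist (\<phi> (t (k + i)) x) (\<phi> (B (k + i)) x) \<le> (\<delta>0 + e) + real L * (2 * e)"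
        proof (rule distances_extend[where lo = T0 and N = N])
          show "T0 \<le> B k" if "- int L * N \<le> k" for k
            using t_late[OF that] B(2)[of k] by linarith
        qed (use N(1) t(2) B close B_dist w t_late in auto)
        ultimately show "4 * \<eta> \<le> (t (k + (i + 1)) - t k) - (t (k + i) - t k) \<and>
            (t (k + (i + 1)) - t k) - (t (k + i) - t k) \<le> r1 \<and>
            4 * \<eta> \<le> (B (k + (i + 1)) - B k) - (B (k + i) - B k) \<and>
            (B (k + (i + 1)) - B k) - (B (k + i) - B k) \<le> r1 \<and>
            dist (\<phi> (t (k + i) - t k) (\<phi> (t k) x)) (\<phi> (B (k + i) - B k) (\<phi> (B k) x)) \<le> \<delta>1"
          using \<rho> \<eta> e(2) \<delta>0(3) by (simp add: flow_add add.assoc abs_le_iff)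
      qed simp_all
      then obtain s where s: "\<And>k. 0 \<le> k \<Longrightarrow> k < N \<Longrightarrow> \<bar>s k\<bar> \<le> \<epsilon>"
        "\<And>k. 0 \<le> k \<Longrightarrow> k < N \<Longrightarrow> dist (\<phi> (t k) x) (\<phi> (s k) (\<phi> (B k) x)) < \<delta>0 / 2"
        by metis
      obtain A' where A': "\<And>k. 0 \<le> k \<Longrightarrow> k < N \<Longrightarrow> A' k = B k + s k" "\<And>k. A' (k + N) = G (A' k)"
        using equivariant_extension[of G G' N "\<lambda>k. B k + s k"] N(1) by auto
      have A'_ge: "t k \<le> A' k" for k
      proof (rule equivariant_le[OF N(1) G_mono])
        fix k assume "0 \<le> k" "k < N"
        then show "t k \<le> A' k"
          using A'(1)[of k] s(1)[of k] B(3)[of k] A(2)[of k] \<epsilon>(3) \<tau> by linarith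
      qed (use t(2) A'(2) in auto)
      have A'_dist: "dist (\<phi> (t k) x) (\<phi> (A' k) x) \<le> \<delta>0 / 2" if "0 \<le> k" "k < N" for k
        using s(2)[OF that] A'(1)[OF that] by (simp add: flow_add less_imp_le)
      have A'N: "A' N = G (A' 0)" "B N = G (B 0)" "t N = G (t 0)"
        using A'(2)[of 0] B(1)[of 0] t(2)[of 0] by simp_all
      have near0: "\<bar>A' 0 - B 0\<bar> \<le> \<epsilon>"
        using A'(1)[of 0] s(1)[of 0] N(1) by simp
      \<comment> \<open>The index \<open>N\<close> opens the next loop, where \<open>A'\<close> is
        given by equivariance and has no shift of its own: the shift at 0 is carried through
        \<open>G\<close> at cost \<open>\<eta>'\<close>.\<close>
      have nearN: "\<bar>A' N - B N\<bar> \<le> \<epsilon> + \<eta>'"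
      proof (cases "B 0 \<le> A' 0")
        case True
        have "\<bar>G (A' 0) - G (B 0) - (A' 0 - B 0)\<bar> < \<eta>'"
          using near0 True \<epsilon>(2) r0(1) late0[of 0] B(2)[of 0] by (intro incG) linarith+
        then show ?thesis unfolding A'N using near0 by linarith
      next
        case False
        have "\<bar>G (B 0) - G (A' 0) - (B 0 - A' 0)\<bar> < \<eta>'"
          using near0 False \<epsilon>(2) r0(1) late0[of 0] A'_ge[of 0] by (intro incG) linarith+
        then show ?thesis unfolding A'N using near0 by linarith
      qed
      \<comment> \<open>The accuracy \<open>\<delta>0 / 2\<close> inside the loop leaves room for
        the cost \<open>2 * e\<close> of passing its end.\<close>
      have distN: "dist (\<phi> (t N) x) (\<phi> (A' N) x) \<le> \<delta>0"
        using close[OF late0[of 0]] close[of "A' 0"] late0[of 0] A'_ge[of 0] A'_dist[of 0] N(1) e(3)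
          dist_triangle[of "\<phi> (G (t 0)) x" "\<phi> (G (A' 0)) x" "\<phi> (t 0) x"]
          dist_triangle[of "\<phi> (t 0) x" "\<phi> (G (A' 0)) x" "\<phi> (A' 0) x"]
        unfolding A'N by (simp add: dist_commute)
      have "good A'"
        unfolding good_def
      proof (intro conjI allI impI A'(2) A'_ge)
        fix k assume "0 \<le> k \<and> k < N"
        then have k: "0 \<le> k" "k < N" by auto
        show "dist (\<phi> (t k) x) (\<phi> (A' k) x) \<le> \<delta>0"
          using A'_dist[OF k] \<delta>0(1) by linarith
        have "\<bar>A' k - B k\<bar> \<le> \<epsilon>"
          using A'(1)[OF k] s(1)[OF k] by simp
        moreover have "\<bar>A' (k + 1) - B (k + 1)\<bar> \<le> \<epsilon> + \<eta>'"
        proof (cases "k + 1 = N")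
          case True
          then show ?thesis using nearN by simp
        next
          case False
          then show ?thesis
            using A'(1)[of "k + 1"] s(1)[of "k + 1"] k \<eta>'(1) by simp
        qed
        \<comment> \<open>The shifts at \<open>k\<close> and \<open>k + 1\<close> are unrelated, so
          only a rough bound is available; it suffices to apply \<open>synchronised\<close>, which
          then gives the sharp one.\<close>
        ultimately have crude: "\<bar>A' (k + 1) - A' k\<bar> \<le> r0 / 2"
          using B_inc[OF k] \<rho>(1,2) \<epsilon>(2) \<eta> \<eta>'(2) by linarith
        have next_dist: "dist (\<phi> (t (k + 1)) x) (\<phi> (A' (k + 1)) x) \<le> \<delta>0"
        proof (cases "k + 1 = N")
          case True
          then show ?thesis using distN by simp
        next
          case False
          then show ?thesis using A'_dist[of "k + 1"] k \<delta>0(1) by simp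
        qed
        have "\<bar>(t (k + 1) - t k) - (A' (k + 1) - A' k)\<bar> < \<eta>"
        proof (rule \<delta>2(2)[of _ _ "\<phi> (t k) x" "\<phi> (A' k) x"])
          show "\<bar>t (k + 1) - t k\<bar> \<le> r0 / 2"
            using t_inc[OF k] \<rho> \<eta> by linarith
          show "dist (\<phi> (t k) x) (\<phi> (A' k) x) \<le> \<delta>2"
            using A'_dist[OF k] \<delta>0 by linarith
          show "dist (\<phi> (t (k + 1) - t k) (\<phi> (t k) x)) (\<phi> (A' (k + 1) - A' k) (\<phi> (A' k) x)) \<le> \<delta>2"
            using next_dist \<delta>0 by (simp add: flow_add)
        qed (rule crude)
        then show "\<bar>A' (k + 1) - A' k - \<rho>\<bar> \<le> \<eta>"
          using t_inc[OF k] by linarith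
      qed
      moreover have "A 0 + \<tau> / 2 \<le> A' 0" "A' 0 \<le> G (A 0) + \<tau>"
        using near0 B(3)[of 0] \<epsilon>(3) \<tau> unfolding B_def by linarith+
      ultimately show ?thesis by blast
    qed
    obtain A where A: "\<And>m. good (A m) \<and> (m = 0 \<longrightarrow> A m = t)"
      "\<And>m. A m 0 + \<tau> / 2 \<le> A (Suc m) 0 \<and> A (Suc m) 0 \<le> G (A m 0) + \<tau>"
      using dependent_nat_choice[of "\<lambda>m A. good A \<and> (m = 0 \<longrightarrow> A = t)"
        "\<lambda>_ A A'. A 0 + \<tau> / 2 \<le> A' 0 \<and> A' 0 \<le> G (A 0) + \<tau>"] good_t step
      by (metis nat.distinct(1))
    \<comment> \<open>The loop length is \<open>A m N - A m 0\<close>, a sum of \<open>N\<close>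
      increments of size at most \<open>\<rho> + \<eta>\<close>.\<close>
    have "G (A m 0) - A m 0 \<le> of_int N * (\<rho> + \<eta>)" for m
    proof -
      have "k \<le> N \<longrightarrow> A m k - A m 0 \<le> of_int k * (\<rho> + \<eta>)" if "0 \<le> k" for k
        using that
      proof (induction k rule: int_ge_induct)
        case (step k)
        have "\<bar>A m (k + 1) - A m k - \<rho>\<bar> \<le> \<eta>" if "k < N"
          using A(1)[of m] step.hyps that by (auto simp: good_def)
        then show ?case using step.IH by (auto simp: algebra_simps)
      qed simp
      from this[of N] show ?thesis
        using N(1) A(1)[of m] unfolding good_def by (metis add_0 less_imp_le order_refl)
    qed
    moreover have "dist (\<phi> T x) (\<phi> (A m 0) x) \<le> \<delta>" for m
      using A(1)[of m] N(1) t0 \<delta>0 unfolding good_def by fastforce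
    ultimately have "return_chain \<delta> T (of_int N * (\<rho> + \<eta>)) (\<lambda>m. A m 0)"
      using A t0 by (simp add: return_chain_def)
    then show "\<exists>C c. return_chain \<delta> T C c" by blast
  qed
qed

text \<open>Bounded loops along a chain have a limit loop, which closes up because its ends become
  arbitrarily close. Chains with small tolerance then bring all late points of the orbit near that
  loop.\<close>

lemma omega_limit_periodic: "periodic_orbit \<phi> (omega_limit \<phi> x)"
proof -
  \<comment> \<open>The tolerance 1 is an arbitrary choice: this chain serves to bound infinitely
    many loop lengths.\<close>
  obtain T C c where "return_chain 1 T C c"
    using shadowing_chain[OF zero_less_one] by blast
  then have c_step: "\<And>m. c m + \<tau> / 2 \<le> c (Suc m)" and c_le: "\<And>m. G (c m) - c m \<le> C"
    by (simp_all add: return_chain_def)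
  have unbounded: "filterlim c at_top sequentially" if "\<And>m. c m + \<tau> / 2 \<le> c (Suc m)" for c :: "nat \<Rightarrow> real"
  proof (rule filterlim_at_top_mono)
    show "filterlim (\<lambda>m. c 0 + real m * (\<tau> / 2)) at_top sequentially"
      using \<tau> by (intro filterlim_tendsto_add_at_top[OF tendsto_const]
          filterlim_at_top_mult_tendsto_pos[OF tendsto_const] filterlim_real_sequentially) simp
    have "c 0 + real m * (\<tau> / 2) \<le> c m" for m
    proof (induction m)
      case (Suc m)
      then show ?case using that[of m] by (simp add: algebra_simps add_divide_distrib)
    qed simp
    then show "\<forall>\<^sub>F m in sequentially. c 0 + real m * (\<tau> / 2) \<le> c m" by simp
  qed

  \<comment> \<open>A periodic point as a limit of loops\<close>
  have "compact ((UNIV :: 'a set) \<times> {\<tau>..C})"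
    by (intro compact_Times cpt compact_Icc)
  moreover have "\<forall>m. (\<phi> (c m) x, G (c m) - c m) \<in> UNIV \<times> {\<tau>..C}"
  proof
    fix m
    show "(\<phi> (c m) x, G (c m) - c m) \<in> UNIV \<times> {\<tau>..C}"
      using c_le[of m] G_gt[of "c m"] by simp
  qed
  ultimately obtain l q where l: "l \<in> (UNIV :: 'a set) \<times> {\<tau>..C}" and q: "strict_mono (q :: nat \<Rightarrow> nat)"
    and lim: "((\<lambda>m. (\<phi> (c m) x, G (c m) - c m)) \<circ> q) \<longlonglongrightarrow> l"
    using compact_imp_seq_compact[of "UNIV \<times> {\<tau>..C}", unfolded seq_compact_def, rule_format,
      of "\<lambda>m. (\<phi> (c m) x, G (c m) - c m)"] by auto
  define s where "s j = c (q j)" for j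
  obtain y S where l_eq: "l = (y, S)" by fastforce
  have y: "(\<lambda>j. \<phi> (s j) x) \<longlonglongrightarrow> y" and S: "(\<lambda>j. G (s j) - s j) \<longlonglongrightarrow> S"
    using tendsto_fst[OF lim] tendsto_snd[OF lim] by (simp_all add: l_eq o_def s_def)
  have "0 < S" using l \<tau> by (simp add: l_eq)
  have s_top: "filterlim s at_top sequentially"
    unfolding s_def by (rule filterlim_compose[OF unbounded[of c, OF c_step] filterlim_subseq[OF q]])
  have "\<phi> S y = y"
  proof -
    have "(\<lambda>j. \<phi> (G (s j) - s j) (\<phi> (s j) x)) \<longlonglongrightarrow> \<phi> S y"
      by (intro tendsto_intros y S)
    then have "(\<lambda>j. dist (\<phi> (s j) x) (\<phi> (G (s j)) x)) \<longlonglongrightarrow> dist y (\<phi> S y)"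
      by (intro tendsto_dist y) (simp add: flow_add)
    moreover have "(\<lambda>j. dist (\<phi> (s j) x) (\<phi> (G (s j)) x)) \<longlonglongrightarrow> 0"
      by (rule filterlim_compose[OF asymptotic s_top])
    ultimately have "dist y (\<phi> S y) = 0"
      by (rule LIMSEQ_unique)
    then show ?thesis by simp
  qed

  \<comment> \<open>Convergence of the orbit to the periodic orbit\<close>
  define R where "R = C + \<tau>"
  have approach: "\<exists>T2. \<forall>T\<ge>T2. \<exists>v\<in>{0..R}. dist (\<phi> T x) (\<phi> v y) \<le> \<delta>" if pos: "0 < \<delta>" for \<delta>
  proof -
    obtain T2 where T2: "\<forall>T\<ge>T2. \<exists>C c. return_chain (\<delta> / 2) T C c"
      using shadowing_chain[OF half_gt_zero[OF pos]] by blast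
    obtain \<delta>' where \<delta>': "0 < \<delta>'" and \<delta>'_close:
      "\<And>s p q. \<bar>s\<bar> \<le> R \<Longrightarrow> dist p q \<le> \<delta>' \<Longrightarrow> dist (\<phi> s p) (\<phi> s q) < \<delta> / 2"
      using flow_uniform[OF half_gt_zero[OF pos] zero_less_one, of R] by blast
    have "\<exists>v\<in>{0..R}. dist (\<phi> T x) (\<phi> v y) \<le> \<delta>" if T: "T2 \<le> T" for T
    proof -
      obtain C' d where "return_chain (\<delta> / 2) T C' d"
        using T2 T by blast
      then have d: "d 0 = T" "\<And>m. d m + \<tau> / 2 \<le> d (Suc m)"
        "\<And>m. d (Suc m) \<le> G (d m) + \<tau>" "\<And>m. dist (\<phi> T x) (\<phi> (d m) x) \<le> \<delta> / 2"
        by (simp_all add: return_chain_def)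
      have "\<forall>\<^sub>F j in sequentially. T < s j"
        using s_top by (simp add: filterlim_at_top_dense)
      moreover have "\<forall>\<^sub>F j in sequentially. dist (\<phi> (s j) x) y < \<delta>'"
        using tendstoD[OF y \<delta>'] .
      ultimately obtain j where j: "T < s j" "dist (\<phi> (s j) x) y < \<delta>'"
        using eventually_happens'[OF sequentially_bot eventually_conj] by blast
      have "\<forall>\<^sub>F m in sequentially. s j \<le> d m"
        using unbounded[of d] d(2) unfolding filterlim_at_top by blast
      then have "\<exists>m. s j \<le> d m"
        by (rule eventually_happens'[OF sequentially_bot])
      \<comment> \<open>The first member of the chain from \<open>T\<close> at or after
        \<open>s j\<close>. Its predecessor lies before \<open>s j\<close>, so
        \<open>d m \<le> G (s j) + \<tau>\<close>, which exceeds \<open>s j\<close> by at most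
        \<open>C + \<tau> = R\<close>; this bound is independent of the tolerance.\<close>
      define m where "m = (LEAST m. s j \<le> d m)"
      have m: "s j \<le> d m"
        unfolding m_def by (rule LeastI_ex) fact
      have "m \<noteq> 0"
        using m j(1) d(1) by (intro notI) simp
      then obtain i where i: "m = Suc i"
        using not0_implies_Suc by blast
      have "d i < s j"
        using not_less_Least[of i "\<lambda>m. s j \<le> d m"] i unfolding m_def by simp
      then have "G (d i) \<le> G (s j)" by simp
      define v where "v = d m - s j"
      have v: "0 \<le> v" "v \<le> R"
        using m d(3)[of i] \<open>G (d i) \<le> G (s j)\<close> c_le[of "q j"]
        unfolding v_def R_def i s_def by linarith+
      have "dist (\<phi> v (\<phi> (s j) x)) (\<phi> v y) < \<delta> / 2"
        using v j(2) by (intro \<delta>'_close) auto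
      then have "dist (\<phi> (d m) x) (\<phi> v y) < \<delta> / 2"
        by (simp add: flow_add v_def)
      then show ?thesis
        using d(4)[of m] v dist_triangle[of "\<phi> T x" "\<phi> v y" "\<phi> (d m) x"]
        by (intro bexI[of _ v]) auto
    qed
    then show ?thesis by blast
  qed
  have "omega_limit \<phi> x = orbit \<phi> y"
  proof
    show "orbit \<phi> y \<subseteq> omega_limit \<phi> x"
    proof
      fix w assume "w \<in> orbit \<phi> y"
      then obtain t where w: "w = \<phi> t y"
        by (auto simp: orbit_def)
      have "filterlim (\<lambda>j. t + s j) at_top sequentially"
        by (rule filterlim_tendsto_add_at_top[OF tendsto_const s_top])
      moreover have "(\<lambda>j. \<phi> t (\<phi> (s j) x)) \<longlonglongrightarrow> w"
        unfolding w by (intro tendsto_intros y)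
      then have "(\<lambda>j. \<phi> (t + s j) x) \<longlonglongrightarrow> w"
        by (simp add: flow_add add.commute)
      ultimately show "w \<in> omega_limit \<phi> x"
        unfolding omega_limit_def by blast
    qed
    show "omega_limit \<phi> x \<subseteq> orbit \<phi> y"
    proof
      fix z assume "z \<in> omega_limit \<phi> x"
      then obtain t where t: "filterlim t at_top sequentially" "(\<lambda>k. \<phi> (t k) x) \<longlonglongrightarrow> z"
        unfolding omega_limit_def by blast
      \<comment> \<open>The fixed arc over \<open>{0..R}\<close> is used in place of the orbit
        because its compactness makes it closed.\<close>
      have "compact ((\<lambda>v. \<phi> v y) ` {0..R})"
        by (intro compact_continuous_image continuous_intros compact_Icc)
      then have closed: "closed ((\<lambda>v. \<phi> v y) ` {0..R})"
        by (rule compact_imp_closed)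
      have "\<exists>w\<in>(\<lambda>v. \<phi> v y) ` {0..R}. dist w z < e" if e: "0 < e" for e
      proof -
        obtain T2 where T2: "\<And>T. T2 \<le> T \<Longrightarrow> \<exists>v\<in>{0..R}. dist (\<phi> T x) (\<phi> v y) \<le> e / 2"
          using approach[OF half_gt_zero[OF e]] by blast
        have "\<forall>\<^sub>F k in sequentially. T2 \<le> t k"
          using t(1) by (simp add: filterlim_at_top)
        moreover have "\<forall>\<^sub>F k in sequentially. dist (\<phi> (t k) x) z < e / 2"
          using tendstoD[OF t(2) half_gt_zero[OF e]] .
        ultimately obtain k where k: "T2 \<le> t k" "dist (\<phi> (t k) x) z < e / 2"
          using eventually_happens'[OF sequentially_bot eventually_conj] by blast
        obtain v where v: "v \<in> {0..R}" "dist (\<phi> (t k) x) (\<phi> v y) \<le> e / 2"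
          using T2[OF k(1)] by blast
        have "dist (\<phi> v y) z < e"
          using v(2) k(2) dist_triangle[of "\<phi> v y" z "\<phi> (t k) x"] by (simp add: dist_commute)
        then show ?thesis using v(1) by blast
      qed
      then have "z \<in> (\<lambda>v. \<phi> v y) ` {0..R}"
        using closed_approachable[OF closed] by blast
      then show "z \<in> orbit \<phi> y"
        by (auto simp: orbit_def)
    qed
  qed
  then show ?thesis
    using \<open>0 < S\<close> \<open>\<phi> S y = y\<close> unfolding periodic_orbit_def by blast
qed

end

theorem theorem3p1:
  fixes \<phi> :: "real \<Rightarrow> 'a::metric_space \<Rightarrow> 'a" and x0 :: 'a
  assumes "compact (UNIV :: 'a set)"
    and "continuous_flow \<phi>"
    and "regular_flow \<phi>"
    and "expansive_flow \<phi>"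
    and "spiral_point \<phi> x0"
  shows "periodic_orbit \<phi> (omega_limit \<phi> x0)"
proof -
  interpret compact_regular_flow \<phi>
    using assms by unfold_locales
  obtain \<tau> G G' where "0 < \<tau>" "homeomorphism UNIV UNIV G G'" "strict_mono G"
    "\<And>t. t + \<tau> < G t" "((\<lambda>t. dist (\<phi> t x0) (\<phi> (G t) x0)) \<longlongrightarrow> 0) at_top"
    using spiral_homeomorphism[OF assms(5)] by blast
  then interpret spiral_flow \<phi> x0 G G' \<tau>
    using assms(4) by unfold_locales
  show ?thesis by (rule omega_limit_periodic)
qed

end
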